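(* Consider the interconnected system $\dot x_i=f_i(t,x_1,\dots,x_m)$, $t\ge t_0$, $i\in\{1,\dots,m\}$, $m\ge2$, with $x_i\in\mathbb{R}^{n_i}$, $n_1+\cdots+n_m=n$, and let $K\subset\mathbb{R}^n$ be a compact set with nonempty interior. Let $A_{\mathrm N}(t,x)=[a_{ij}(t,x)]\in\mathbb{R}^{m\times m}$ be the interconnection matrix function $$a_{ii}(t,x):=\mu_i\big(J_{x_i}f_i(t,x)\big),\qquad a_{ij}(t,x):=\big\|J_{x_j}f_i(t,x)\big\|_{ij}\quad(i\ne j).$$ Suppose there exists a Metzler matrix $\hat A_{\mathrm N}=[\hat a_{ij}]\in\mathbb{R}^{m\times m}$ such that $$\hat a_{ij}\ge\limsup_{t\to\infty}\ \max_{v\in\operatorname{co}(\xi(t,t_0,K))}a_{ij}(t,v)\qquad\text{for all } i,j\in\{1,\dots,m\}.$$ Then the topological entropy of the interconnected system satisfies $$h(f,t_0,K)\le n\max\{\lambda_{\max}(\hat A_{\mathrm N}),\,0\}.$$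
   Context: Write $x=(x_1,\dots,x_m)\in\mathbb{R}^n$ and $f=(f_1,\dots,f_m)$. Standing assumptions: $f(t,x)$ is piecewise continuous in $t$, continuously differentiable in $x$, and $\dot x=f(t,x)$ is forward complete. $\xi(t,t_0,x)$ denotes the solution at time $t$ with state $x$ at time $t_0$, and $\xi(t,t_0,K):=\{\xi(t,t_0,x):x\in K\}$. $J_{x_j}f_i(t,v)$ is the Jacobian matrix of $f_i(t,x)$ with respect to $x_j$ at $x=v$. $\operatorname{co}$ denotes convex hull. Norms: for each $i$, a ("local") norm $|\cdot|_i$ on $\mathbb{R}^{n_i}$ is given, with induced norm $\|\cdot\|_i$ on $\mathbb{R}^{n_i\times n_i}$, matrix measure $\mu_i(A):=\lim_{t\searrow0}\frac{\|I+tA\|_i-1}{t}$, and mixed induced norms $\|A\|_{ij}:=\max_{|v|_j=1}|Av|_i$ on $\mathbb{R}^{n_i\times n_j}$. A Metzler matrix is a real square matrix with nonnegative off-diagonal entries; $\lambda_{\max}(M)$ denotes its eigenvalue with the largest real part (which is real). Topological entropy: fix a norm $|\cdot|$ on $\mathbb{R}^n$ (the entropy does not depend on this choice). For $T\ge0$, $\varepsilon>0$, let $B_{f,t_0}(x,\varepsilon,T):=\{\bar x\in\mathbb{R}^n:\max_{t\in[t_0,t_0+T]}|\xi(t,t_0,\bar x)-\xi(t,t_0,x)|<\varepsilon\}$. A subset $E\subset K$ is $(T,\varepsilon)$-spanning if $K\subset\bigcup_{x\in E}B_{f,t_0}(x,\varepsilon,T)$; $S(f,t_0,\varepsilon,T,K)$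 is the minimal cardinality of a $(T,\varepsilon)$-spanning set. Then $h(f,t_0,K):=\lim_{\varepsilon\searrow0}\limsup_{T\to\infty}\frac1T\log S(f,t_0,\varepsilon,T,K)$ (natural logarithm).
   Formalization: "Continuously differentiable in x" is taken to include that the Jacobian of f in x is bounded on bounded sets of (t,x), t ≥ t0; with only pointwise-in-t differentiability, solutions need not be unique and ξ would be undefined. *)

theory Defs
  imports "HOL-Analysis.Analysis"
begin

section \<open>Time-varying systems and their solutions\<close>

definition piecewise_continuous_from :: "real \<Rightarrow> (real \<Rightarrow> 'a::topological_space) \<Rightarrow> bool" where
  "piecewise_continuous_from a g \<longleftrightarrow>
     (\<exists>D. (\<forall>b. finite (D \<inter> {a..b})) \<and>
          (\<forall>t\<in>{a..} - D. continuous (at t within {a..}) g) \<and>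
          (\<forall>t\<in>D. (t \<ge> a \<longrightarrow> (\<exists>l. (g \<longlongrightarrow> l) (at_right t))) \<and>
                 (t > a \<longrightarrow> (\<exists>l. (g \<longlongrightarrow> l) (at_left t)))))"

text \<open>
  Continuous differentiability in the state, locally uniformly in time: besides
  f(t, .) being of class C1 for each t, the Jacobian is bounded on bounded sets of pairs (t, x)
  (equivalently, f is Lipschitz in x on such sets). Without such a uniformity in time the initial
  value problem need not have unique solutions. It holds, for instance, if between consecutive
  switching times the Jacobian extends to a jointly continuous function of (t, x) on the closed
  time interval.
\<close>

definition C1_in_state :: "real \<Rightarrow> (real \<Rightarrow> real ^ 'n \<Rightarrow> real ^ 'n) \<Rightarrow> bool" where
  "C1_in_state t0 f \<longleftrightarrow>
     (\<forall>t\<ge>t0. (\<forall>x. f t differentiable at x) \<and>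
             continuous_on UNIV (\<lambda>x. jacobian (f t) (at x))) \<and>
     (\<forall>b r. bounded {jacobian (f t) (at x) | t x. t \<in> {t0..b} \<and> x \<in> cball 0 r})"

text \<open>
  As f is only piecewise continuous in time, a solution of x' = f(t, x) with state x at time s is a
  solution of the integral equation (its derivative may fail to exist at discontinuities of f).
  The integral equation forces continuity and the initial condition.
\<close>

definition solution_from ::
  "(real \<Rightarrow> real ^ 'n \<Rightarrow> real ^ 'n) \<Rightarrow> real \<Rightarrow> real ^ 'n \<Rightarrow> (real \<Rightarrow> real ^ 'n) \<Rightarrow> bool" where
  "solution_from f s x \<phi> \<longleftrightarrow>
     (\<forall>t\<ge>s. ((\<lambda>\<tau>. f \<tau> (\<phi> \<tau>)) has_integral (\<phi> t - x)) {s..t})"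

definition forward_complete :: "real \<Rightarrow> (real \<Rightarrow> real ^ 'n \<Rightarrow> real ^ 'n) \<Rightarrow> bool" where
  "forward_complete t0 f \<longleftrightarrow> (\<forall>s\<ge>t0. \<forall>x. \<exists>\<phi>. solution_from f s x \<phi>)"

definition xi :: "(real \<Rightarrow> real ^ 'n \<Rightarrow> real ^ 'n) \<Rightarrow> real \<Rightarrow> real \<Rightarrow> real ^ 'n \<Rightarrow> real ^ 'n" where
  "xi f t t0 x = (THE y. \<exists>\<phi>. solution_from f t0 x \<phi> \<and> \<phi> t = y)"

section \<open>Norms on blocks, mixed induced norms and matrix measures\<close>

definition norm_on :: "(real ^ 'n) set \<Rightarrow> (real ^ 'n \<Rightarrow> real) \<Rightarrow> bool" where
  "norm_on V N \<longleftrightarrow>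
     (\<forall>v\<in>V. N v \<ge> 0 \<and> (N v = 0 \<longleftrightarrow> v = 0)) \<and>
     (\<forall>v\<in>V. \<forall>c. N (c *\<^sub>R v) = \<bar>c\<bar> * N v) \<and>
     (\<forall>v\<in>V. \<forall>w\<in>V. N (v + w) \<le> N v + N w)"

text \<open>
  The splitting of the state x into components x_i, i in 'm, is given by a map blk assigning to
  each scalar coordinate the component it belongs to; n_i is the number of coordinates assigned
  to i. The space of the i-th component is identified with the coordinate subspace of vectors
  supported on block i, and n_i x n_j matrices with the matrices supported on rows of block i and
  columns of block j.
\<close>

definition block_space :: "('n \<Rightarrow> 'm) \<Rightarrow> 'm \<Rightarrow> (real ^ 'n) set" where
  "block_space blk i = {v. \<forall>k. blk k \<noteq> i \<longrightarrow> v $ k = 0}"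

definition submat :: "('n \<Rightarrow> 'm) \<Rightarrow> 'm \<Rightarrow> 'm \<Rightarrow> real ^ 'n ^ 'n \<Rightarrow> real ^ 'n ^ 'n" where
  "submat blk i j A = (\<chi> k l. if blk k = i \<and> blk l = j then A $ k $ l else 0)"

text \<open>
  Only meant for matrices mapping block space j into block space i. The supremum is over the image
  of the compact unit sphere of block space j, hence a maximum.
\<close>

definition mixed_norm ::
  "('n \<Rightarrow> 'm) \<Rightarrow> ('m \<Rightarrow> real ^ 'n \<Rightarrow> real) \<Rightarrow> 'm \<Rightarrow> 'm \<Rightarrow> real ^ 'n ^ 'n \<Rightarrow> real" where
  "mixed_norm blk nrm i j A = (SUP v\<in>{v \<in> block_space blk j. nrm j v = 1}. nrm i (A *v v))"

text \<open>The unit matrix below acts on block space i as its identity.\<close>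

definition matrix_measure ::
  "('n \<Rightarrow> 'm) \<Rightarrow> ('m \<Rightarrow> real ^ 'n \<Rightarrow> real) \<Rightarrow> 'm \<Rightarrow> real ^ 'n ^ 'n \<Rightarrow> real" where
  "matrix_measure blk nrm i A =
     Lim (at_right 0) (\<lambda>t. (mixed_norm blk nrm i i (mat 1 + t *\<^sub>R A) - 1) / t)"

definition interconnection_matrix ::
  "('n \<Rightarrow> 'm) \<Rightarrow> ('m \<Rightarrow> real ^ 'n \<Rightarrow> real) \<Rightarrow> (real \<Rightarrow> real ^ 'n \<Rightarrow> real ^ 'n) \<Rightarrow>
   real \<Rightarrow> real ^ 'n \<Rightarrow> real ^ 'm ^ 'm" where
  "interconnection_matrix blk nrm f t x =
     (\<chi> i j. if i = j
             then matrix_measure blk nrm i (submat blk i i (jacobian (f t) (at x)))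
             else mixed_norm blk nrm i j (submat blk i j (jacobian (f t) (at x))))"

section \<open>Metzler matrices\<close>

definition metzler :: "real ^ 'm ^ 'm \<Rightarrow> bool" where
  "metzler M \<longleftrightarrow> (\<forall>i j. i \<noteq> j \<longrightarrow> M $ i $ j \<ge> 0)"

definition eigenvalues :: "real ^ 'm ^ 'm \<Rightarrow> complex set" where
  "eigenvalues M = {z. \<exists>v. v \<noteq> 0 \<and> map_matrix complex_of_real M *v v = z *s v}"

text \<open>
  The largest real part of an eigenvalue. For a Metzler matrix this number is itself an eigenvalue.
\<close>

definition lambda_max :: "real ^ 'm ^ 'm \<Rightarrow> real" where
  "lambda_max M = Max (Re ` eigenvalues M)"

section \<open>Topological entropy\<close>

text \<open>The argument N is the norm on the state space; the supremum is attained by continuity.\<close>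

definition entropy_ball ::
  "(real ^ 'n \<Rightarrow> real) \<Rightarrow> (real \<Rightarrow> real ^ 'n \<Rightarrow> real ^ 'n) \<Rightarrow> real \<Rightarrow>
   real ^ 'n \<Rightarrow> real \<Rightarrow> real \<Rightarrow> (real ^ 'n) set" where
  "entropy_ball N f t0 x \<epsilon> T =
     {x'. (SUP t\<in>{t0..t0 + T}. N (xi f t t0 x' - xi f t t0 x)) < \<epsilon>}"

definition is_spanning ::
  "(real ^ 'n \<Rightarrow> real) \<Rightarrow> (real \<Rightarrow> real ^ 'n \<Rightarrow> real ^ 'n) \<Rightarrow> real \<Rightarrow>
   real \<Rightarrow> real \<Rightarrow> (real ^ 'n) set \<Rightarrow> (real ^ 'n) set \<Rightarrow> bool" where
  "is_spanning N f t0 \<epsilon> T K E \<longleftrightarrow> E \<subseteq> K \<and> K \<subseteq> (\<Union>x\<in>E. entropy_ball N f t0 x \<epsilon> T)"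

text \<open>The value is infinite if there is no finite spanning set.\<close>

definition spanning_number ::
  "(real ^ 'n \<Rightarrow> real) \<Rightarrow> (real \<Rightarrow> real ^ 'n \<Rightarrow> real ^ 'n) \<Rightarrow> real \<Rightarrow>
   real \<Rightarrow> real \<Rightarrow> (real ^ 'n) set \<Rightarrow> enat" where
  "spanning_number N f t0 \<epsilon> T K =
     (INF E\<in>{E. finite E \<and> is_spanning N f t0 \<epsilon> T K E}. enat (card E))"

definition log_enat :: "enat \<Rightarrow> ereal" where
  "log_enat s = (case s of enat k \<Rightarrow> if k = 0 then - \<infinity> else ereal (ln (real k)) | \<infinity> \<Rightarrow> \<infinity>)"

definition topological_entropy ::
  "(real ^ 'n \<Rightarrow> real) \<Rightarrow> (real \<Rightarrow> real ^ 'n \<Rightarrow> real ^ 'n) \<Rightarrow> real \<Rightarrow> (real ^ 'n) set \<Rightarrow> ereal" where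
  "topological_entropy N f t0 K =
     Lim (at_right 0) (\<lambda>\<epsilon>. Limsup at_top (\<lambda>T. log_enat (spanning_number N f t0 \<epsilon> T K) / ereal T))"

end

theory Submission
  imports Defs
begin

text \<open>
  The difference e of two solutions starting in K satisfies e' = A(t) e outside a countable set of
  times, where A(t) is a convex combination of Jacobians at points of the convex hull of the
  reach set. Matrix measures and induced norms being convex, the interconnection matrix of A(t) is
  eventually bounded by that of the hypothesis plus an arbitrarily small constant. For every
  c above the largest eigenvalue of the given Metzler matrix M there is a positive vector w with
  M w < c w; hence the weighted maximum over i of |e_i|_i / w_i, a norm on the whole state space,
  grows at most like exp(c t). Covering K by O(r^(-n)) balls of radius r proportional to
  exp(-c T) then gives spanning sets of exponential growth rate n c, if c is nonnegative.
\<close>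

text \<open>Two sources of nonsmoothness lead to one-sided differential inequalities: f is only
  piecewise continuous in t, with switching times depending on x, and the block norms need not be
  differentiable. Matrix measures fit in as right derivatives: |v + h A v| is at most (1 + h \<mu>)
  |v| up to o(h) |v|. Unlike a norm of A, a measure may be negative, so stable diagonal blocks
  remain visible in the bound. The rate c is taken strictly above the largest eigenvalue because at
  that value a positive w with M w \<le> c w may fail to exist: for the 2 x 2 Jordan block with
  eigenvalue 0 it would force the second entry of w to be nonpositive. The strict inequality M w < c
  w also pays for the passage from a limsup to an entrywise bound valid from some time a on. The
  time before a costs only a constant factor, which does not affect an exponential rate. A negative
  c would not help: spanning sets must follow solutions on the whole time interval including its
  start, so the radius of the initial balls can never exceed a constant times \<epsilon>. This is
  where the maximum with 0 comes from.\<close>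

section \<open>Differential inequalities with countably many exceptions\<close>

text \<open>Were V b > V a, each level y strictly between would be crossed for the last time at some t,
  to the right of which V exceeds V t = y; uncountably many such t would have to lie in S.\<close>

lemma nonincreasing_if_right_nonincreasing:
  fixes V :: "real \<Rightarrow> real"
  assumes ab: "a \<le> b" and cont: "continuous_on {a..b} V" and S: "countable S"
    and step: "\<And>t. t \<in> {a..<b} - S \<Longrightarrow> eventually (\<lambda>s. V s \<le> V t) (at_right t)"
  shows "V b \<le> V a"
proof (rule ccontr)
  assume "\<not> V b \<le> V a"
  then have less: "V a < V b" by simp
  have "\<exists>t\<in>{a..<b}. V t = y \<and> (\<forall>s\<in>{t<..b}. y < V s)" if y: "y \<in> {V a<..<V b}" for y
  proof -
    let ?L = "{t \<in> {a..b}. V t = y}"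
    have "closed ?L"
      by (rule continuous_closed_preimage_constant[OF cont]) simp
    then have "compact ?L"
      using compact_Int_closed[OF compact_Icc, of ?L a b] by (simp only: Int_absorb1 Collect_restrict)
    moreover have "?L \<noteq> {}"
    proof -
      have "V a \<le> y" "y \<le> V b" using y by auto
      from IVT'[OF this ab cont] show ?thesis by auto
    qed
    ultimately obtain t where t: "t \<in> ?L" and tmax: "\<And>s. s \<in> ?L \<Longrightarrow> s \<le> t"
      using compact_attains_sup[of ?L] by blast
    have above: "y < V s" if s: "s \<in> {t<..b}" for s
    proof (rule ccontr)
      assume "\<not> y < V s"
      moreover have "continuous_on {s..b} V"
        by (rule continuous_on_subset[OF cont]) (use s t in auto)
      ultimately obtain u where "s \<le> u" "u \<le> b" "V u = y"
        using IVT'[of V s y b] y s by auto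
      then show False using tmax[of u] s t by auto
    qed
    have "t \<noteq> b" using t y by auto
    then have "t \<in> {a..<b}" "V t = y" using t by auto
    with above show ?thesis by blast
  qed
  then obtain \<tau> where \<tau>: "\<And>y. y \<in> {V a<..<V b} \<Longrightarrow> \<tau> y \<in> {a..<b}"
      "\<And>y. y \<in> {V a<..<V b} \<Longrightarrow> V (\<tau> y) = y"
      "\<And>y s. y \<in> {V a<..<V b} \<Longrightarrow> s \<in> {\<tau> y<..b} \<Longrightarrow> y < V s"
    by metis
  have "\<tau> y \<in> S" if y: "y \<in> {V a<..<V b}" for y
  proof (rule ccontr)
    assume "\<tau> y \<notin> S"
    then have "eventually (\<lambda>s. V s \<le> V (\<tau> y)) (at_right (\<tau> y))"
      by (intro step DiffI \<tau>(1)[OF y])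
    moreover have "eventually (\<lambda>s. s \<in> {\<tau> y<..<b}) (at_right (\<tau> y))"
      using \<tau>(1)[OF y] by (intro eventually_at_right_real) simp
    ultimately have "eventually (\<lambda>s. False) (at_right (\<tau> y))"
    proof eventually_elim
      case (elim s)
      then have "V (\<tau> y) < V s" using \<tau>(3)[OF y, of s] \<tau>(2)[OF y] by simp
      with elim(1) show False by simp
    qed
    then show False by simp
  qed
  then have "countable (\<tau> ` {V a<..<V b})"
    by (intro countable_subset[OF _ S]) (rule image_subsetI)
  moreover have "inj_on \<tau> {V a<..<V b}"
    by (rule inj_on_inverseI[where g = V]) (rule \<tau>(2))
  ultimately have "countable {V a<..<V b}"
    using countable_image_inj_on by blast
  then show False
    using uncountable_open_interval[of "V a" "V b"] less by simp
qed

text \<open>The integrating factor exp (- c (s - a)) removes the linear term, and subtracting \<eta>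
  (s - a) makes the resulting function strictly smaller immediately to the right of each admissible
  t, so that the preceding lemma applies. Then \<eta> tends to 0.\<close>

lemma dini_gronwall:
  fixes V :: "real \<Rightarrow> real"
  assumes ab: "a \<le> b" and cont: "continuous_on {a..b} V" and S: "countable S"
    and step: "\<And>t \<epsilon>. t \<in> {a..<b} - S \<Longrightarrow> \<epsilon> > 0 \<Longrightarrow>
      eventually (\<lambda>s. V s \<le> V t + (s - t) * (c * V t + \<epsilon>)) (at_right t)"
  shows "V b \<le> exp (c * (b - a)) * V a"
proof -
  have bound: "exp (- c * (b - a)) * V b - \<eta> * (b - a) \<le> V a" if \<eta>: "\<eta> > 0" for \<eta>
  proof -
    define W where "W = (\<lambda>s. exp (- c * (s - a)) * V s - \<eta> * (s - a))"
    have "W b \<le> W a"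
    proof (rule nonincreasing_if_right_nonincreasing[OF ab _ S])
      show "continuous_on {a..b} W"
        unfolding W_def by (intro continuous_intros cont)
      fix t assume t: "t \<in> {a..<b} - S"
      \<comment> \<open>Chosen so that the majorant \<open>G\<close> below has derivative exactly -
        \<eta> / 2 at t.\<close>
      define \<epsilon> where "\<epsilon> = \<eta> / 2 * exp (c * (t - a))"
      have \<epsilon>: "\<epsilon> > 0" using \<eta> by (simp add: \<epsilon>_def)
      \<comment> \<open>\<open>W\<close> with V s replaced by its assumed upper bound:
        \<open>G\<close> lies above \<open>W\<close> to the right of t, agrees with it at t, and is
        differentiable.\<close>
      define G where
        "G = (\<lambda>s. exp (- c * (s - a)) * (V t + (s - t) * (c * V t + \<epsilon>)) - \<eta> * (s - a))"
      have "(G has_real_derivative exp (- c * (t - a)) * \<epsilon> - \<eta>) (at t)"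
        unfolding G_def by (auto intro!: derivative_eq_intros simp: algebra_simps)
      moreover have "exp (- c * (t - a)) * \<epsilon> - \<eta> = - \<eta> / 2"
      proof -
        have "exp (- c * (t - a)) * exp (c * (t - a)) = 1" by (simp flip: exp_add)
        moreover have "exp (- c * (t - a)) * \<epsilon> = \<eta> / 2 * (exp (- c * (t - a)) * exp (c * (t - a)))"
          by (simp only: \<epsilon>_def mult_ac)
        ultimately have "exp (- c * (t - a)) * \<epsilon> = \<eta> / 2" by (simp only: mult_1_right)
        then show ?thesis by linarith
      qed
      ultimately obtain d where d: "d > 0" "\<And>h. h > 0 \<Longrightarrow> h < d \<Longrightarrow> G (t + h) < G t"
        using DERIV_neg_dec_right[of G "- \<eta> / 2" t] \<eta> by auto
      have "eventually (\<lambda>s. s \<in> {t<..<t + d}) (at_right t)"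
        using d by (intro eventually_at_right_real) auto
      with step[OF t \<epsilon>] show "eventually (\<lambda>s. W s \<le> W t) (at_right t)"
      proof eventually_elim
        case (elim s)
        have "W s \<le> G s" using elim(1) by (simp add: W_def G_def)
        also have "\<dots> < G t" using d(2)[of "s - t"] elim(2) by simp
        also have "G t = W t" by (simp add: W_def G_def)
        finally show ?case by simp
      qed
    qed
    then show ?thesis by (simp add: W_def)
  qed
  have "exp (- c * (b - a)) * V b \<le> V a + \<delta>" if "\<delta> > 0" for \<delta>
  proof -
    \<comment> \<open>The denominator b - a + 1 instead of b - a covers the case a = b.\<close>
    have "\<delta> / (b - a + 1) * (b - a) \<le> \<delta>"
      using that ab by (simp add: field_simps)
    then show ?thesis
      using bound[of "\<delta> / (b - a + 1)"] that ab by simp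
  qed
  then have "exp (- c * (b - a)) * V b \<le> V a"
    by (rule field_le_epsilon)
  moreover have "exp (c * (b - a)) * exp (- c * (b - a)) = 1"
    by (simp flip: exp_add)
  ultimately show ?thesis
    by (metis exp_ge_zero mult.assoc mult_1 mult_left_mono)
qed

lemma has_vector_derivative_right_remainder:
  assumes "(e has_vector_derivative d) (at t within {t..})" and "\<epsilon> > 0"
  shows "eventually (\<lambda>s. norm (e s - e t - (s - t) *\<^sub>R d) \<le> \<epsilon> * (s - t)) (at_right t)"
proof -
  obtain \<delta> where \<delta>: "\<delta> > 0" and
    le: "\<And>s. s \<in> {t..} \<Longrightarrow> norm (s - t) < \<delta> \<Longrightarrow> norm (e s - e t - (s - t) *\<^sub>R d) \<le> \<epsilon> * norm (s - t)"
    using assms unfolding has_vector_derivative_def has_derivative_within_alt by blast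
  have "eventually (\<lambda>s. s \<in> {t<..<t + \<delta>}) (at_right t)"
    using \<delta> by (intro eventually_at_right_real) auto
  then show ?thesis
  proof eventually_elim
    case (elim s) then show ?case using le[of s] by auto
  qed
qed

lemma norm_triangle3: "norm (a + b + c) \<le> norm a + norm b + norm (c :: 'a :: real_normed_vector)"
  using norm_triangle_ineq[of "a + b" c] norm_triangle_ineq[of a b] by simp

section \<open>Solutions of the system\<close>

locale regular_system =
  fixes f :: "real \<Rightarrow> real ^ 'n \<Rightarrow> real ^ 'n" and t0 :: real
  assumes piecewise: "piecewise_continuous_from t0 (\<lambda>t. f t x)"
    and C1: "C1_in_state t0 f"
begin

lemma jacobian_derivative:
  "t \<ge> t0 \<Longrightarrow> (f t has_derivative (\<lambda>h. jacobian (f t) (at x) *v h)) (at x)"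
  using C1 jacobian_works[of "f t" "at x"] unfolding C1_in_state_def by blast

text \<open>The joint bound on the Jacobians in \<open>C1_in_state\<close> makes L uniform in time;
  the ball is convex, so the mean value inequality applies on it.\<close>

lemma lipschitz_on_bounded:
  obtains L where "L \<ge> 0"
    "\<And>t x y. t \<in> {t0..b} \<Longrightarrow> norm x \<le> r \<Longrightarrow> norm y \<le> r \<Longrightarrow> norm (f t x - f t y) \<le> L * norm (x - y)"
proof -
  have "bounded {jacobian (f t) (at x) | t x. t \<in> {t0..b} \<and> x \<in> cball 0 r}"
    using C1 unfolding C1_in_state_def by blast
  then obtain B where B: "\<And>t x. t \<in> {t0..b} \<Longrightarrow> norm x \<le> r \<Longrightarrow> norm (jacobian (f t) (at x)) \<le> B"
    unfolding bounded_iff by auto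
  define L where "L = real CARD('n) * real CARD('n) * \<bar>B\<bar>"
  show thesis
  proof
    show "L \<ge> 0" by (simp add: L_def)
    fix t and x y :: "real ^ 'n" assume t: "t \<in> {t0..b}" and xy: "norm x \<le> r" "norm y \<le> r"
    have "onorm (\<lambda>h. jacobian (f t) (at z) *v h) \<le> L" if "z \<in> cball 0 r" for z
      unfolding L_def
    proof (rule onorm_le_matrix_component)
      fix i j
      have "\<bar>jacobian (f t) (at z) $ i $ j\<bar> \<le> norm (jacobian (f t) (at z))"
        by (metis Finite_Cartesian_Product.norm_nth_le order_trans real_norm_def)
      then show "\<bar>jacobian (f t) (at z) $ i $ j\<bar> \<le> \<bar>B\<bar>"
        using B[OF t, of z] that by simp
    qed
    then show "norm (f t x - f t y) \<le> L * norm (x - y)"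
      using t xy
      by (intro differentiable_bound[where S = "cball 0 r"])
        (auto intro: has_derivative_at_withinI jacobian_derivative)
  qed
qed

text \<open>The discontinuity times of f(., q) depend on q; by the Lipschitz bound it suffices to
  exclude those belonging to a countable dense set of states q.\<close>

lemma countable_exceptional_times:
  obtains S where "countable S"
    "\<And>t \<phi>. t \<ge> t0 \<Longrightarrow> t \<notin> S \<Longrightarrow> continuous (at t within {t0..}) \<phi> \<Longrightarrow>
      continuous (at t within {t0..}) (\<lambda>s. f s (\<phi> s))"
proof -
  obtain Q :: "(real ^ 'n) set" where Q: "countable Q" and
    dense: "\<And>X. open X \<Longrightarrow> X \<noteq> {} \<Longrightarrow> \<exists>q\<in>Q. q \<in> X"
    using countable_dense_exists by blast
  have "\<exists>D. \<forall>q. (\<forall>b. finite (D q \<inter> {t0..b})) \<and>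
      (\<forall>t\<in>{t0..} - D q. continuous (at t within {t0..}) (\<lambda>t. f t q))"
    using piecewise unfolding piecewise_continuous_from_def by metis
  then obtain D where fin: "\<And>q b. finite (D q \<inter> {t0..b})" and
    contD: "\<And>q t. t \<in> {t0..} - D q \<Longrightarrow> continuous (at t within {t0..}) (\<lambda>t. f t q)"
    by blast
  \<comment> \<open>\<open>D q\<close> is known to be finite only on bounded intervals starting at
    t0, hence the intersections.\<close>
  define S where "S = (\<Union>q\<in>Q. \<Union>n::nat. D q \<inter> {t0..t0 + real n})"
  show thesis
  proof
    show "countable S"
      unfolding S_def by (rule countable_UN[OF Q(1)], rule countable_UN) (simp_all add: countable_finite fin)
    fix t and \<phi> :: "real \<Rightarrow> real ^ 'n"
    assume t: "t \<ge> t0" "t \<notin> S" and \<phi>: "continuous (at t within {t0..}) \<phi>"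
    define r where "r = norm (\<phi> t) + 1"
    obtain L where L: "L \<ge> 0"
      "\<And>s x y. s \<in> {t0..t + 1} \<Longrightarrow> norm x \<le> r \<Longrightarrow> norm y \<le> r \<Longrightarrow> norm (f s x - f s y) \<le> L * norm (x - y)"
      using lipschitz_on_bounded by blast
    show "continuous (at t within {t0..}) (\<lambda>s. f s (\<phi> s))"
      unfolding continuous_within
    proof (rule tendstoI)
      fix \<epsilon> :: real assume \<epsilon>: "\<epsilon> > 0"
      \<comment> \<open>The difference is split through f s q and f t q: the Lipschitz terms cost at
        most 2 L \<delta> \<le> \<epsilon> / 3 and L \<delta> \<le> \<epsilon> / 6, the continuity
        of f(., q) at t less than \<epsilon> / 3. The cap 1/2 keeps q and \<phi> s in the ball of
        radius r.\<close>
      define \<delta> where "\<delta> = min (1/2) (\<epsilon> / (6 * (L + 1)))"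
      have \<delta>: "\<delta> > 0" "2 * \<delta> \<le> 1" using \<epsilon> L by (auto simp: \<delta>_def)
      have "L * \<delta> \<le> (L + 1) * (\<epsilon> / (6 * (L + 1)))"
        using L \<epsilon> \<delta> by (intro mult_mono) (auto simp: \<delta>_def)
      also have "\<dots> = \<epsilon> / 6" using L by (simp add: field_simps)
      finally have L\<delta>: "L * \<delta> \<le> \<epsilon> / 6" .
      obtain q where q: "q \<in> Q" "dist (\<phi> t) q < \<delta>"
        using dense[of "ball (\<phi> t) \<delta>"] \<delta> by auto
      have nq: "norm q \<le> r" "norm (q - \<phi> t) < \<delta>"
      proof -
        show *: "norm (q - \<phi> t) < \<delta>" using q by (simp add: dist_norm norm_minus_commute)
        show "norm q \<le> r"
          using norm_triangle_ineq[of "\<phi> t" "q - \<phi> t"] * \<delta> by (simp add: r_def)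
      qed
      obtain n :: nat where "t - t0 \<le> real n" using real_arch_simple by blast
      then have "t \<in> {t0..t0 + real n}" using t by simp
      then have "t \<notin> D q" using t(2) q(1) unfolding S_def by blast
      then have "((\<lambda>s. f s q) \<longlongrightarrow> f t q) (at t within {t0..})"
        using contD[of t q] t by (simp add: continuous_within)
      then have "eventually (\<lambda>s. dist (f s q) (f t q) < \<epsilon> / 3) (at t within {t0..})"
        using \<epsilon> by (intro tendstoD) auto
      moreover have "eventually (\<lambda>s. dist (\<phi> s) (\<phi> t) < \<delta>) (at t within {t0..})"
        using \<phi> \<delta> unfolding continuous_within by (intro tendstoD)
      moreover have "eventually (\<lambda>s. s \<in> {t0..t + 1}) (at t within {t0..})"
        unfolding eventually_at by (rule exI[of _ 1]) (auto simp: dist_real_def)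
      ultimately show "eventually (\<lambda>s. dist (f s (\<phi> s)) (f t (\<phi> t)) < \<epsilon>) (at t within {t0..})"
      proof eventually_elim
        case (elim s)
        have n1: "norm (\<phi> s) \<le> r"
          using norm_triangle_ineq[of "\<phi> t" "\<phi> s - \<phi> t"] elim(2) \<delta> by (simp add: r_def dist_norm)
        have n2: "norm (\<phi> s - q) \<le> 2 * \<delta>"
          using norm_triangle_ineq[of "\<phi> s - \<phi> t" "\<phi> t - q"] elim(2) nq(2)
          by (simp add: dist_norm norm_minus_commute)
        have "norm (f s (\<phi> s) - f s q) \<le> L * norm (\<phi> s - q)"
          using L(2) elim(3) n1 nq(1) by blast
        also have "\<dots> \<le> L * (2 * \<delta>)" using n2 L(1) by (rule mult_left_mono)
        finally have 1: "norm (f s (\<phi> s) - f s q) \<le> \<epsilon> / 3" using L\<delta> by simp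
        have "norm (f t q - f t (\<phi> t)) \<le> L * norm (q - \<phi> t)"
          using L(2)[of t q "\<phi> t"] t nq(1) by (simp add: r_def)
        also have "\<dots> \<le> L * \<delta>" using nq(2) L(1) by (intro mult_left_mono) auto
        finally have 2: "norm (f t q - f t (\<phi> t)) \<le> \<epsilon> / 6" using L\<delta> by simp
        have "f s (\<phi> s) - f t (\<phi> t) = (f s (\<phi> s) - f s q) + (f s q - f t q) + (f t q - f t (\<phi> t))"
          by simp
        then have "norm (f s (\<phi> s) - f t (\<phi> t)) \<le>
            norm (f s (\<phi> s) - f s q) + norm (f s q - f t q) + norm (f t q - f t (\<phi> t))"
          using norm_triangle3 by metis
        then show ?case using 1 2 elim(1) \<epsilon> by (simp add: dist_norm)
      qed
    qed
  qed
qed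

section \<open>Regularity and uniqueness of solutions of the integral equation\<close>

lemma solution_initial:
  assumes "solution_from f t0 x \<phi>" shows "\<phi> t0 = x"
proof -
  have "((\<lambda>s. f s (\<phi> s)) has_integral (\<phi> t0 - x)) {t0..t0}"
    using assms unfolding solution_from_def by blast
  moreover have "((\<lambda>s. f s (\<phi> s)) has_integral 0) {t0..t0}"
    using has_integral_refl(2)[of "\<lambda>s. f s (\<phi> s)" t0] by simp
  ultimately have "\<phi> t0 - x = 0" by (rule has_integral_unique)
  then show ?thesis by simp
qed

lemma solution_integral:
  assumes "solution_from f t0 x \<phi>" and "t \<ge> t0"
  shows "(\<lambda>s. f s (\<phi> s)) integrable_on {t0..t}" and "\<phi> t = x + integral {t0..t} (\<lambda>s. f s (\<phi> s))"
proof -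
  have *: "((\<lambda>s. f s (\<phi> s)) has_integral (\<phi> t - x)) {t0..t}"
    using assms unfolding solution_from_def by blast
  then show "(\<lambda>s. f s (\<phi> s)) integrable_on {t0..t}" by blast
  show "\<phi> t = x + integral {t0..t} (\<lambda>s. f s (\<phi> s))"
    using integral_unique[OF *] by simp
qed

lemma solution_continuous_on:
  assumes "solution_from f t0 x \<phi>" shows "continuous_on {t0..b} \<phi>"
proof -
  have "continuous_on {t0..b} (\<lambda>t. x + integral {t0..t} (\<lambda>s. f s (\<phi> s)))"
    using solution_integral(1)[OF assms, of b]
    by (cases "t0 \<le> b") (auto intro!: continuous_intros indefinite_integral_continuous_1)
  then show ?thesis
    by (rule continuous_on_eq) (use solution_integral(2)[OF assms] in auto)
qed

lemma solution_continuous_within: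
  assumes "solution_from f t0 x \<phi>" "t \<ge> t0" shows "continuous (at t within {t0..}) \<phi>"
proof -
  have "continuous (at t within {t0..t + 1}) \<phi>"
    using solution_continuous_on[OF assms(1), of "t + 1"] assms(2)
    by (auto simp: continuous_on_eq_continuous_within)
  moreover have "at t within {t0..} = at t within {t0..t + 1}"
    by (rule at_within_nhd[of t "{t - 1<..<t + 1}"]) auto
  ultimately show ?thesis by simp
qed

text \<open>The exceptional set is chosen before the solution, so differences of solutions can be
  differentiated off one common countable set. One-sided derivatives are what
  \<open>dini_gronwall\<close> consumes.\<close>

lemma solution_right_derivative:
  obtains S where "countable S"
    "\<And>t x \<phi>. solution_from f t0 x \<phi> \<Longrightarrow> t \<ge> t0 \<Longrightarrow> t \<notin> S \<Longrightarrow>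
      (\<phi> has_vector_derivative f t (\<phi> t)) (at t within {t..})"
proof -
  obtain S where S: "countable S"
    "\<And>t \<phi>. t \<ge> t0 \<Longrightarrow> t \<notin> S \<Longrightarrow> continuous (at t within {t0..}) \<phi> \<Longrightarrow>
      continuous (at t within {t0..}) (\<lambda>s. f s (\<phi> s))"
    using countable_exceptional_times by blast
  show thesis
  proof
    show "countable S" by fact
    fix t x \<phi> assume sol: "solution_from f t0 x \<phi>" and t: "t \<ge> t0" "t \<notin> S"
    let ?b = "t + 1"
    have "continuous (at t within {t0..?b}) (\<lambda>s. f s (\<phi> s))"
      using S(2)[OF t solution_continuous_within[OF sol t(1)]] by (rule continuous_within_subset) auto
    then have "((\<lambda>u. integral {t0..u} (\<lambda>s. f s (\<phi> s))) has_vector_derivative f t (\<phi> t))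
        (at t within {t0..?b})"
      using solution_integral(1)[OF sol, of ?b] t
      by (intro integral_has_vector_derivative_continuous_at[where S = "{}", simplified]) auto
    then have "((\<lambda>u. x + integral {t0..u} (\<lambda>s. f s (\<phi> s))) has_vector_derivative f t (\<phi> t))
        (at t within {t0..?b})"
      by (auto intro!: derivative_eq_intros)
    then have "(\<phi> has_vector_derivative f t (\<phi> t)) (at t within {t0..?b})"
      using t by (rule_tac has_vector_derivative_transform) (use solution_integral(2)[OF sol] in auto)
    then have "(\<phi> has_vector_derivative f t (\<phi> t)) (at t within {t..?b})"
      by (rule has_vector_derivative_within_subset) (use t in auto)
    moreover have "at t within {t..} = at t within {t..?b}"
      by (rule at_within_nhd[of t "{t - 1<..<t + 1}"]) auto
    ultimately show "(\<phi> has_vector_derivative f t (\<phi> t)) (at t within {t..})" by simp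
  qed
qed

text \<open>The Lipschitz estimate is asked for only along the two solutions and strictly before b,
  as a first-exit argument can provide no more.\<close>

lemma solutions_distance:
  assumes "solution_from f t0 x \<phi>" "solution_from f t0 y \<psi>" and ab: "t0 \<le> b"
    and L: "\<And>t. t \<in> {t0..<b} \<Longrightarrow> norm (f t (\<phi> t) - f t (\<psi> t)) \<le> L * norm (\<phi> t - \<psi> t)"
  shows "norm (\<phi> b - \<psi> b) \<le> exp (L * (b - t0)) * norm (x - y)"
proof -
  obtain S where S: "countable S"
    "\<And>t x \<phi>. solution_from f t0 x \<phi> \<Longrightarrow> t \<ge> t0 \<Longrightarrow> t \<notin> S \<Longrightarrow>
      (\<phi> has_vector_derivative f t (\<phi> t)) (at t within {t..})"
    using solution_right_derivative by blast
  define e where "e = (\<lambda>t. \<phi> t - \<psi> t)"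
  have "norm (e b) \<le> exp (L * (b - t0)) * norm (e t0)"
  proof (rule dini_gronwall[OF ab _ S(1)])
    show "continuous_on {t0..b} (\<lambda>t. norm (e t))"
      unfolding e_def by (intro continuous_intros assms(1,2)[THEN solution_continuous_on])
    fix t \<epsilon> assume t: "t \<in> {t0..<b} - S" and \<epsilon>: "(\<epsilon>::real) > 0"
    let ?d = "f t (\<phi> t) - f t (\<psi> t)"
    have "(e has_vector_derivative ?d) (at t within {t..})"
      unfolding e_def using t by (intro derivative_intros S(2)[OF assms(1)] S(2)[OF assms(2)]) auto
    from has_vector_derivative_right_remainder[OF this \<epsilon>]
    have "eventually (\<lambda>s. norm (e s - e t - (s - t) *\<^sub>R ?d) \<le> \<epsilon> * (s - t)) (at_right t)" .
    moreover have "eventually (\<lambda>s. s > t) (at_right t)" by (rule eventually_at_right_less)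
    ultimately show "eventually (\<lambda>s. norm (e s) \<le> norm (e t) + (s - t) * (L * norm (e t) + \<epsilon>)) (at_right t)"
    proof eventually_elim
      case (elim s)
      have "e s = e t + (s - t) *\<^sub>R ?d + (e s - e t - (s - t) *\<^sub>R ?d)" by simp
      then have "norm (e s) \<le> norm (e t) + norm ((s - t) *\<^sub>R ?d) + norm (e s - e t - (s - t) *\<^sub>R ?d)"
        using norm_triangle3 by metis
      also have "norm ((s - t) *\<^sub>R ?d) \<le> (s - t) * (L * norm (e t))"
        using elim(2) L[of t] t by (simp add: e_def)
      finally show ?case using elim(1) by (simp add: algebra_simps)
    qed
  qed
  then show ?thesis
    using assms(1,2)[THEN solution_initial] by (simp add: e_def)
qed

lemma solution_bounded:
  assumes "solution_from f t0 x \<phi>"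
  obtains r where "r \<ge> 0" "\<And>t. t \<in> {t0..b} \<Longrightarrow> norm (\<phi> t) \<le> r"
proof -
  have "bounded (\<phi> ` {t0..b})"
    using compact_continuous_image[OF solution_continuous_on[OF assms]] compact_imp_bounded by blast
  then obtain r where r: "r > 0" "\<And>y. y \<in> \<phi> ` {t0..b} \<Longrightarrow> norm y \<le> r"
    unfolding bounded_pos by blast
  show thesis
  proof (rule that)
    show "r \<ge> 0" using r(1) by simp
  qed (intro r(2) imageI)
qed

lemma solution_unique:
  assumes "solution_from f t0 x \<phi>" "solution_from f t0 x \<psi>" "t0 \<le> t"
  shows "\<phi> t = \<psi> t"
proof -
  obtain r where r: "\<And>s. s \<in> {t0..t} \<Longrightarrow> norm (\<phi> s) \<le> r"
    using solution_bounded[OF assms(1), of t] by metis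
  obtain r' where r': "\<And>s. s \<in> {t0..t} \<Longrightarrow> norm (\<psi> s) \<le> r'"
    using solution_bounded[OF assms(2), of t] by metis
  obtain L where L: "\<And>s x y. s \<in> {t0..t} \<Longrightarrow> norm x \<le> max r r' \<Longrightarrow> norm y \<le> max r r' \<Longrightarrow>
      norm (f s x - f s y) \<le> L * norm (x - y)"
    using lipschitz_on_bounded by metis
  have "norm (\<phi> t - \<psi> t) \<le> exp (L * (t - t0)) * norm (x - x)"
    by (rule solutions_distance[OF assms]) (intro L, auto simp: r r' le_max_iff_disj)
  then show ?thesis by simp
qed

lemma xi_eq_solution:
  assumes "solution_from f t0 x \<phi>" "t0 \<le> t"
  shows "xi f t t0 x = \<phi> t"
  unfolding xi_def using assms solution_unique by (intro the_equality) auto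

end

section \<open>Forward complete systems and the dependence of the flow on the initial state\<close>

locale complete_system = regular_system f t0
  for f :: "real \<Rightarrow> real ^ 'n \<Rightarrow> real ^ 'n" and t0 :: real +
  assumes complete: "forward_complete t0 f"
begin

abbreviation flow :: "real ^ 'n \<Rightarrow> real \<Rightarrow> real ^ 'n" where
  "flow x t \<equiv> xi f t t0 x"

lemma flow_solution: "solution_from f t0 x (flow x)"
proof -
  obtain \<phi> where \<phi>: "solution_from f t0 x \<phi>"
    using complete unfolding forward_complete_def by blast
  have "((\<lambda>s. f s (flow x s)) has_integral (flow x t - x)) {t0..t}" if "t \<ge> t0" for t
  proof -
    have "((\<lambda>s. f s (\<phi> s)) has_integral (flow x t - x)) {t0..t}"
      using \<phi> that xi_eq_solution[OF \<phi> that] unfolding solution_from_def by simp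
    \<comment> \<open>Before t0 the value of \<open>xi\<close> is unspecified; the integral only
      sees {t0..t}, where the flow agrees with \<phi>.\<close>
    then show ?thesis
      by (rule has_integral_eq[rotated]) (simp add: xi_eq_solution[OF \<phi>])
  qed
  then show ?thesis unfolding solution_from_def by blast
qed

text \<open>First-exit argument: as long as a neighbouring solution is closer than 1 to that of x,
  both stay in a ball with a fixed Lipschitz constant, and Gronwall then prevents the distance from
  reaching 1.\<close>

lemma flow_bounded_near:
  assumes b: "t0 \<le> b"
  obtains \<delta> R where "\<delta> > 0" "\<And>y t. y \<in> ball x \<delta> \<Longrightarrow> t \<in> {t0..b} \<Longrightarrow> norm (flow y t) \<le> R"
proof -
  obtain r where r: "\<And>t. t \<in> {t0..b} \<Longrightarrow> norm (flow x t) \<le> r"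
    using solution_bounded[OF flow_solution] by metis
  obtain L where L: "L \<ge> 0" "\<And>t u v. t \<in> {t0..b} \<Longrightarrow> norm u \<le> r + 1 \<Longrightarrow> norm v \<le> r + 1 \<Longrightarrow>
      norm (f t u - f t v) \<le> L * norm (u - v)"
    using lipschitz_on_bounded by metis
  \<comment> \<open>The radius at which the Gronwall factor up to time b yields exactly 1.\<close>
  define \<delta> where "\<delta> = exp (- L * (b - t0))"
  have close: "norm (flow x t - flow y t) < 1" if y: "y \<in> ball x \<delta>" and t: "t \<in> {t0..b}" for y t
  proof (rule ccontr)
    define d where "d = (\<lambda>s. norm (flow x s - flow y s))"
    assume "\<not> norm (flow x t - flow y t) < 1"
    then have dt: "d t \<ge> 1" by (simp add: d_def)
    have contd: "continuous_on {t0..t} d"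
      unfolding d_def by (intro continuous_intros solution_continuous_on[OF flow_solution])
    let ?X = "{s \<in> {t0..t}. d s \<in> {1..}}"
    have "closed ?X"
      using continuous_closed_preimage[OF contd, of "{1..}"] by (simp add: vimage_def Int_def)
    then have "compact ?X"
      using compact_Int_closed[OF compact_Icc, of ?X t0 t] by (simp only: Int_absorb1 Collect_restrict)
    moreover have "?X \<noteq> {}" using t dt by auto
    \<comment> \<open>The first time at which the distance is at least 1.\<close>
    ultimately obtain s where s: "s \<in> ?X" and smin: "\<And>u. u \<in> ?X \<Longrightarrow> s \<le> u"
      using compact_attains_inf[of ?X] by blast
    have "norm (flow x s - flow y s) \<le> exp (L * (s - t0)) * norm (x - y)"
    proof (rule solutions_distance[OF flow_solution flow_solution])
      show "t0 \<le> s" using s by auto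
      fix u assume u: "u \<in> {t0..<s}"
      then have "d u < 1" using smin[of u] s by force
      then have "norm (flow y u) \<le> r + 1"
        using r[of u] u s t norm_triangle_ineq2[of "flow y u" "flow x u"]
        by (simp add: d_def norm_minus_commute)
      moreover have "norm (flow x u) \<le> r + 1" "u \<in> {t0..b}" using r[of u] u s t by auto
      ultimately show "norm (f u (flow x u) - f u (flow y u)) \<le> L * norm (flow x u - flow y u)"
        using L(2) by blast
    qed
    also have "\<dots> \<le> exp (L * (b - t0)) * norm (x - y)"
      using s t L(1) by (intro mult_right_mono) (auto intro!: mult_left_mono)
    also have "\<dots> < exp (L * (b - t0)) * \<delta>"
      using y by (simp add: dist_norm)
    also have "\<dots> = 1" by (simp add: \<delta>_def exp_minus)
    finally show False using s by (simp add: d_def)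
  qed
  show thesis
  proof
    show "\<delta> > 0" by (simp add: \<delta>_def)
    fix y t assume "y \<in> ball x \<delta>" "t \<in> {t0..b}"
    then show "norm (flow y t) \<le> r + 1"
      using close[of y t] r[of t] norm_triangle_ineq2[of "flow y t" "flow x t"]
      by (simp add: norm_minus_commute)
  qed
qed

lemma flow_bounded:
  assumes b: "t0 \<le> b" and K: "compact K"
  obtains R where "\<And>x t. x \<in> K \<Longrightarrow> t \<in> {t0..b} \<Longrightarrow> norm (flow x t) \<le> R"
proof -
  obtain \<delta> R where \<delta>: "\<And>x. \<delta> x > 0" and
    R: "\<And>x y t. y \<in> ball x (\<delta> x) \<Longrightarrow> t \<in> {t0..b} \<Longrightarrow> norm (flow y t) \<le> R x"
  proof -
    have "\<exists>\<delta> R. \<delta> > 0 \<and> (\<forall>y\<in>ball x \<delta>. \<forall>t\<in>{t0..b}. norm (flow y t) \<le> R)" for x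
      by (rule flow_bounded_near[OF b, of x]) blast
    then obtain \<delta> R where
      "\<And>x. \<delta> x > 0 \<and> (\<forall>y\<in>ball x (\<delta> x). \<forall>t\<in>{t0..b}. norm (flow y t) \<le> R x)"
      by metis
    then show ?thesis using that by blast
  qed
  have "K \<subseteq> (\<Union>x\<in>K. ball x (\<delta> x))" using \<delta> by force
  then obtain F where F: "F \<subseteq> K" "finite F" "K \<subseteq> (\<Union>x\<in>F. ball x (\<delta> x))"
    using compactE_image[OF K, of K "\<lambda>x. ball x (\<delta> x)"] by auto
  show thesis
  proof
    fix y t assume "y \<in> K" "t \<in> {t0..b}"
    then obtain x where "x \<in> F" "norm (flow y t) \<le> R x" using F R by blast
    then show "norm (flow y t) \<le> Max (R ` F)"
      using F(2) by (auto intro: order_trans)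
  qed
qed

text \<open>Serves the initial period, before the asymptotic bound on the interconnection matrix
  takes effect.\<close>

lemma flow_lipschitz_on_compact:
  assumes b: "t0 \<le> b" and K: "compact K"
  obtains C where "C \<ge> 1"
    "\<And>x y t. x \<in> K \<Longrightarrow> y \<in> K \<Longrightarrow> t \<in> {t0..b} \<Longrightarrow> norm (flow x t - flow y t) \<le> C * norm (x - y)"
proof -
  obtain R where R: "\<And>x t. x \<in> K \<Longrightarrow> t \<in> {t0..b} \<Longrightarrow> norm (flow x t) \<le> R"
    using flow_bounded[OF assms] by metis
  obtain L where L: "L \<ge> 0" "\<And>t u v. t \<in> {t0..b} \<Longrightarrow> norm u \<le> R \<Longrightarrow> norm v \<le> R \<Longrightarrow>
      norm (f t u - f t v) \<le> L * norm (u - v)"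
    using lipschitz_on_bounded by metis
  show thesis
  proof
    show "exp (L * (b - t0)) \<ge> 1" using L b by simp
    fix x y t assume xy: "x \<in> K" "y \<in> K" and t: "t \<in> {t0..b}"
    have "norm (flow x t - flow y t) \<le> exp (L * (t - t0)) * norm (x - y)"
      using t xy by (intro solutions_distance[OF flow_solution flow_solution] L(2) R) auto
    also have "\<dots> \<le> exp (L * (b - t0)) * norm (x - y)"
      using t L(1) by (intro mult_right_mono) (auto intro!: mult_left_mono)
    finally show "norm (flow x t - flow y t) \<le> exp (L * (b - t0)) * norm (x - y)" .
  qed
qed

end

section \<open>Block norms and matrix measures\<close>

lemma norm_on_UNIV_bound:
  assumes N: "norm_on UNIV N"
  obtains C where "C > 0" "\<And>v. N v \<le> C * norm v"
proof
  have add: "N (v + w) \<le> N v + N w" and scale: "N (c *\<^sub>R v) = \<bar>c\<bar> * N v" and nn: "N v \<ge> 0" for v w c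
    using N by (auto simp: norm_on_def)
  have N0: "N 0 = 0" using N by (auto simp: norm_on_def)
  have sum: "N (sum g A) \<le> (\<Sum>k\<in>A. N (g k))" if "finite A" for A and g :: "'b \<Rightarrow> real ^ 'a"
    using that by (induction A rule: finite_induct) (auto simp: N0 intro: order_trans[OF add])
  define C where "C = (\<Sum>k\<in>UNIV. N (axis k 1)) + 1"
  show "C > 0" unfolding C_def by (intro add_nonneg_pos sum_nonneg nn) simp
  fix v :: "real ^ 'a"
  have "N v = N (\<Sum>k\<in>UNIV. (v $ k) *\<^sub>R axis k 1)"
    using basis_expansion[of v] by (simp add: scalar_mult_eq_scaleR)
  also have "\<dots> \<le> (\<Sum>k\<in>UNIV. N ((v $ k) *\<^sub>R axis k 1))" by (rule sum) simp
  also have "\<dots> \<le> (\<Sum>k\<in>UNIV. norm v * N (axis k 1))"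
    unfolding scale by (intro sum_mono mult_right_mono nn component_le_norm_cart)
  also have "\<dots> \<le> C * norm v" by (simp add: C_def algebra_simps flip: sum_distrib_left)
  finally show "N v \<le> C * norm v" .
qed

lemma norm_on_UNIV_continuous:
  assumes N: "norm_on UNIV N" shows "continuous_on S N"
proof -
  obtain C where C: "C > 0" "\<And>v. N v \<le> C * norm v" using norm_on_UNIV_bound[OF N] by blast
  have le: "N v \<le> N w + C * norm (v - w)" for v w
  proof -
    have "N (w + (v - w)) \<le> N w + N (v - w)" using N unfolding norm_on_def by blast
    then show ?thesis using C(2)[of "v - w"] by simp
  qed
  have "C-lipschitz_on S N"
  proof (rule lipschitz_onI)
    fix v w show "dist (N v) (N w) \<le> C * dist v w"
      using le[of v w] le[of w v] by (simp add: dist_norm abs_le_iff norm_minus_commute)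
  qed (use C in simp)
  then show ?thesis by (rule lipschitz_on_continuous_on)
qed

lemma norm_on_UNIV_lower_bound:
  assumes N: "norm_on UNIV N"
  obtains c where "c > 0" "\<And>v. norm v \<le> c * N v"
proof -
  let ?S = "sphere (0 :: real ^ 'a) 1"
  have "axis undefined 1 \<in> ?S" by simp
  then have "?S \<noteq> {}" by blast
  then obtain u where u: "u \<in> ?S" "\<And>v. v \<in> ?S \<Longrightarrow> N u \<le> N v"
    using continuous_attains_inf[OF compact_sphere _ norm_on_UNIV_continuous[OF N], of 0 1] by blast
  have Nu: "N u > 0"
  proof -
    have "u \<noteq> 0" using u(1) by auto
    moreover have "N u \<ge> 0" "N u = 0 \<longleftrightarrow> u = 0" using N by (auto simp: norm_on_def)
    ultimately show ?thesis by linarith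
  qed
  show thesis
  proof
    show "1 / N u > 0" using Nu by simp
    fix v show "norm v \<le> 1 / N u * N v"
    proof (cases "v = 0")
      case True then show ?thesis using N by (simp add: norm_on_def)
    next
      case False
      have "N u \<le> N ((1 / norm v) *\<^sub>R v)" using u(2) False by simp
      also have "\<dots> = \<bar>1 / norm v\<bar> * N v" using N unfolding norm_on_def by blast
      finally show ?thesis using Nu False by (simp add: field_simps)
    qed
  qed
qed

section \<open>Coordinate blocks of vectors and matrices\<close>

definition block_proj :: "('n \<Rightarrow> 'm) \<Rightarrow> 'm \<Rightarrow> real ^ 'n \<Rightarrow> real ^ 'n" where
  "block_proj blk i v = (\<chi> k. if blk k = i then v $ k else 0)"

lemma block_proj_in: "block_proj blk i v \<in> block_space blk i"
  by (simp add: block_proj_def block_space_def)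

lemma block_proj_add: "block_proj blk i (v + w) = block_proj blk i v + block_proj blk i w"
  by (simp add: block_proj_def vec_eq_iff)

lemma block_proj_scaleR: "block_proj blk i (c *\<^sub>R v) = c *\<^sub>R block_proj blk i v"
  by (simp add: block_proj_def vec_eq_iff)

lemma block_proj_eq: "v \<in> block_space blk i \<Longrightarrow> block_proj blk i v = v"
  by (auto simp: block_proj_def block_space_def vec_eq_iff)

lemma block_proj_other: "v \<in> block_space blk i \<Longrightarrow> j \<noteq> i \<Longrightarrow> block_proj blk j v = 0"
  by (auto simp: block_proj_def block_space_def vec_eq_iff)

lemma block_space_0: "0 \<in> block_space blk i"
  by (simp add: block_space_def)

lemma block_space_add: "v \<in> block_space blk i \<Longrightarrow> w \<in> block_space blk i \<Longrightarrow> v + w \<in> block_space blk i"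
  by (simp add: block_space_def)

lemma block_space_scaleR: "v \<in> block_space blk i \<Longrightarrow> c *\<^sub>R v \<in> block_space blk i"
  by (simp add: block_space_def)

text \<open>\<open>submat blk i j A\<close> is P_i A P_j for the coordinate projections P_i and
  P_j.\<close>

lemma submat_mult: "submat blk i j A *v v = block_proj blk i (A *v block_proj blk j v)"
  by (auto simp: submat_def block_proj_def vec_eq_iff matrix_vector_mult_def intro!: sum.cong)

lemma submat_add: "submat blk i j (A + B) = submat blk i j A + submat blk i j B"
  by (simp add: submat_def vec_eq_iff)

lemma submat_scaleR: "submat blk i j (c *\<^sub>R A) = c *\<^sub>R submat blk i j A"
  by (simp add: submat_def vec_eq_iff)

lemma block_proj_matrix_mult:
  fixes blk :: "'n::finite \<Rightarrow> 'm::finite"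
  shows "block_proj blk i (A *v v) = (\<Sum>j\<in>UNIV. submat blk i j A *v block_proj blk j v)"
proof -
  have v: "(\<Sum>j\<in>UNIV. block_proj blk j v) = v"
    by (simp add: vec_eq_iff block_proj_def)
  have pp: "block_proj blk j (block_proj blk j v) = block_proj blk j v" for j
    by (rule block_proj_eq) (rule block_proj_in)
  have lin: "linear (block_proj blk i)"
    by (rule linearI) (simp_all add: block_proj_add block_proj_scaleR)
  have "(\<Sum>j\<in>UNIV. submat blk i j A *v block_proj blk j v) = block_proj blk i (\<Sum>j\<in>UNIV. A *v block_proj blk j v)"
    by (simp add: submat_mult pp linear_sum[OF lin])
  also have "(\<Sum>j\<in>UNIV. A *v block_proj blk j v) = A *v (\<Sum>j\<in>UNIV. block_proj blk j v)"
    using linear_sum[OF matrix_vector_mul_linear[of A], of "\<lambda>j. block_proj blk j v" UNIV] by simp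
  finally show ?thesis by (simp add: v)
qed

section \<open>Block norms and the weighted maximum norm built from them\<close>

locale block_norms =
  fixes blk :: "'n::finite \<Rightarrow> 'm::finite" and nrm :: "'m \<Rightarrow> real ^ 'n \<Rightarrow> real"
  assumes surj_blk: "surj blk" and norm_block: "norm_on (block_space blk i) (nrm i)"
begin

lemma nrm_nonneg: "v \<in> block_space blk i \<Longrightarrow> nrm i v \<ge> 0"
  using norm_block[of i] by (auto simp: norm_on_def)

lemma nrm_eq_0: "v \<in> block_space blk i \<Longrightarrow> nrm i v = 0 \<longleftrightarrow> v = 0"
  using norm_block[of i] by (auto simp: norm_on_def)

lemma nrm_0: "nrm i 0 = 0"
  by (simp add: nrm_eq_0 block_space_0)

lemma nrm_scaleR: "v \<in> block_space blk i \<Longrightarrow> nrm i (c *\<^sub>R v) = \<bar>c\<bar> * nrm i v"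
  using norm_block[of i] by (auto simp: norm_on_def)

lemma nrm_add:
  "v \<in> block_space blk i \<Longrightarrow> w \<in> block_space blk i \<Longrightarrow> nrm i (v + w) \<le> nrm i v + nrm i w"
  using norm_block[of i] by (auto simp: norm_on_def)

lemma nrm_sum:
  assumes "finite S" "\<And>k. k \<in> S \<Longrightarrow> g k \<in> block_space blk i"
  shows "(\<Sum>k\<in>S. g k) \<in> block_space blk i \<and> nrm i (\<Sum>k\<in>S. g k) \<le> (\<Sum>k\<in>S. nrm i (g k))"
  using assms
proof (induction S rule: finite_induct)
  case empty then show ?case by (simp add: nrm_0 block_space_0)
next
  case (insert k S)
  then show ?case
    using nrm_add[of "g k" i "\<Sum>k\<in>S. g k"] by (auto intro!: block_space_add)
qed

text \<open>The Lyapunov function of the proof. Its balls are the sets where the vector of block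
  norms lies below a multiple of w, so a componentwise inequality B w \<le> c w turns into growth at
  rate c.\<close>

definition wnorm :: "real ^ 'm \<Rightarrow> real ^ 'n \<Rightarrow> real" where
  "wnorm w v = Max (range (\<lambda>i. nrm i (block_proj blk i v) / w $ i))"

lemma wnorm_le_iff: "wnorm w v \<le> r \<longleftrightarrow> (\<forall>i. nrm i (block_proj blk i v) / w $ i \<le> r)"
  by (simp add: wnorm_def)

lemma wnorm_ge: "nrm i (block_proj blk i v) / w $ i \<le> wnorm w v"
  using wnorm_le_iff[of w v "wnorm w v"] by simp

lemma norm_on_wnorm:
  assumes w: "\<And>i. w $ i > 0"
  shows "norm_on UNIV (wnorm w)"
proof -
  have nn: "wnorm w v \<ge> 0" for v
    by (rule order_trans[OF _ wnorm_ge])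
      (simp add: nrm_nonneg block_proj_in less_imp_le[OF w])
  have zero: "wnorm w v = 0 \<longleftrightarrow> v = 0" for v
  proof
    assume *: "wnorm w v = 0"
    have "block_proj blk i v = 0" for i
    proof -
      have "nrm i (block_proj blk i v) \<le> 0"
        using wnorm_ge[of i v w] w[of i] * by (simp add: divide_le_0_iff)
      then show ?thesis
        using nrm_nonneg[OF block_proj_in, of i v] nrm_eq_0[OF block_proj_in, of i v] by linarith
    qed
    \<comment> \<open>Every coordinate is visible in the block it belongs to.\<close>
    then have "block_proj blk (blk k) v $ k = 0" for k by simp
    then have "v $ k = 0" for k by (simp add: block_proj_def)
    then show "v = 0" by (simp add: vec_eq_iff)
  next
    assume "v = 0"
    then have "block_proj blk i v = 0" for i by (simp add: block_proj_def vec_eq_iff)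
    then have "wnorm w v \<le> 0" by (simp add: wnorm_le_iff nrm_0)
    then show "wnorm w v = 0" using nn[of v] by simp
  qed
  have add: "wnorm w (u + v) \<le> wnorm w u + wnorm w v" for u v
    unfolding wnorm_le_iff
  proof
    fix i
    have "nrm i (block_proj blk i (u + v)) / w $ i \<le>
        (nrm i (block_proj blk i u) + nrm i (block_proj blk i v)) / w $ i"
      unfolding block_proj_add
      by (intro divide_right_mono nrm_add block_proj_in less_imp_le[OF w])
    also have "\<dots> \<le> wnorm w u + wnorm w v"
      using wnorm_ge[of i u w] wnorm_ge[of i v w] by (simp add: add_divide_distrib)
    finally show "nrm i (block_proj blk i (u + v)) / w $ i \<le> wnorm w u + wnorm w v" .
  qed
  have scale_le: "wnorm w (c *\<^sub>R v) \<le> \<bar>c\<bar> * wnorm w v" for c v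
    unfolding wnorm_le_iff block_proj_scaleR nrm_scaleR[OF block_proj_in]
    using mult_left_mono[OF wnorm_ge, of "\<bar>c\<bar>"] by simp
  have scale: "wnorm w (c *\<^sub>R v) = \<bar>c\<bar> * wnorm w v" for c v
  proof (cases "c = 0")
    case True then show ?thesis by (simp add: zero)
  next
    case False
    \<comment> \<open>The converse inequality is \<open>scale_le\<close> for the factor 1 /
      c.\<close>
    have "wnorm w v \<le> \<bar>1 / c\<bar> * wnorm w (c *\<^sub>R v)"
      using scale_le[of "1 / c" "c *\<^sub>R v"] False by simp
    then have "\<bar>c\<bar> * wnorm w v \<le> wnorm w (c *\<^sub>R v)"
      using False by (simp add: field_simps)
    then show ?thesis using scale_le[of c v] by simp
  qed
  show ?thesis unfolding norm_on_def using nn zero add scale by simp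
qed

text \<open>With all weights equal to 1 the weighted norm restricts to \<open>nrm i\<close> on block
  space i, so equivalence with the Euclidean norm is inherited from the full space, with one
  constant for all blocks.\<close>

lemma block_norm_equivalent:
  obtains C where "C > 0" "\<And>i v. v \<in> block_space blk i \<Longrightarrow> nrm i v \<le> C * norm v"
    "\<And>i v. v \<in> block_space blk i \<Longrightarrow> norm v \<le> C * nrm i v"
proof -
  have *: "norm_on UNIV (wnorm 1)" by (rule norm_on_wnorm) simp
  have eq: "wnorm 1 v = nrm i v" if v: "v \<in> block_space blk i" for i v
  proof (rule antisym)
    have "nrm j (block_proj blk j v) \<le> nrm i v" for j
      using v by (cases "j = i") (simp_all add: block_proj_eq block_proj_other nrm_0 nrm_nonneg)
    then show "wnorm 1 v \<le> nrm i v" by (simp add: wnorm_le_iff)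
    show "nrm i v \<le> wnorm 1 v" using wnorm_ge[of i v 1] v by (simp add: block_proj_eq)
  qed
  obtain C where C: "C > 0" "\<And>v. wnorm 1 v \<le> C * norm v" using norm_on_UNIV_bound[OF *] by blast
  obtain c where c: "c > 0" "\<And>v. norm v \<le> c * wnorm 1 v" using norm_on_UNIV_lower_bound[OF *] by blast
  show thesis
  proof
    show "max C c > 0" using C by simp
    fix i v assume v: "v \<in> block_space blk i"
    have "C * norm v \<le> max C c * norm v" by (intro mult_right_mono) auto
    then show "nrm i v \<le> max C c * norm v" using C(2)[of v] eq[OF v] by simp
    have "c * nrm i v \<le> max C c * nrm i v" by (intro mult_right_mono) (auto simp: nrm_nonneg[OF v])
    then show "norm v \<le> max C c * nrm i v" using c(2)[of v] eq[OF v] by simp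
  qed
qed

section \<open>Matrices between block spaces and their mixed induced norms\<close>

definition maps_block :: "'m \<Rightarrow> 'm \<Rightarrow> real ^ 'n ^ 'n \<Rightarrow> bool" where
  "maps_block i j A \<longleftrightarrow> (\<forall>v\<in>block_space blk j. A *v v \<in> block_space blk i)"

lemma maps_block_submat: "maps_block i j (submat blk i j A)"
  by (simp add: maps_block_def submat_mult block_proj_in)

lemma maps_block_combine: "maps_block i j A \<Longrightarrow> maps_block i j B \<Longrightarrow> maps_block i j (s *\<^sub>R A + t *\<^sub>R B)"
  by (simp add: maps_block_def matrix_vector_mult_add_rdistrib block_space_add block_space_scaleR
      flip: scaleR_matrix_vector_assoc)

text \<open>The reason for working with \<open>maps_block\<close> instead of matrices supported on
  one block: mat 1 + t A, as it occurs in the matrix measure, satisfies only the former in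
  general.\<close>

lemma maps_block_mat_1: "maps_block i i (mat 1)"
  by (simp add: maps_block_def)

text \<open>Surjectivity of \<open>blk\<close> enters here; over an empty sphere the supremum in
  \<open>mixed_norm\<close> would carry no information.\<close>

lemma unit_sphere_nonempty: "\<exists>v. v \<in> block_space blk j \<and> nrm j v = 1"
proof -
  obtain k where k: "blk k = j" using surj_blk by (metis surjD)
  let ?e = "axis k 1 :: real ^ 'n"
  have e: "?e \<in> block_space blk j" using k by (auto simp: block_space_def axis_def)
  have "nrm j ?e > 0"
    using nrm_nonneg[OF e] nrm_eq_0[OF e] by (simp add: axis_eq_0_iff order_less_le)
  then show ?thesis
    using e by (intro exI[of _ "(1 / nrm j ?e) *\<^sub>R ?e"]) (simp add: block_space_scaleR nrm_scaleR)
qed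

text \<open>Nothing is known of \<open>nrm i\<close> outside block space i, hence the hypothesis on
  A. Comparison with the Euclidean operator norm shows that the supremum is taken over a bounded
  set, so it really is an upper bound.\<close>

lemma nrm_mult_le:
  assumes A: "maps_block i j A" and v: "v \<in> block_space blk j"
  shows "nrm i (A *v v) \<le> mixed_norm blk nrm i j A * nrm j v"
proof (cases "v = 0")
  case True then show ?thesis by (simp add: nrm_0)
next
  case False
  obtain C where C: "C > 0" "\<And>i v. v \<in> block_space blk i \<Longrightarrow> nrm i v \<le> C * norm v"
    "\<And>i v. v \<in> block_space blk i \<Longrightarrow> norm v \<le> C * nrm i v"
    using block_norm_equivalent by blast
  let ?S = "{v \<in> block_space blk j. nrm j v = 1}"
  have bdd: "bdd_above ((\<lambda>v. nrm i (A *v v)) ` ?S)"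
  proof (rule bdd_aboveI2)
    fix u assume u: "u \<in> ?S"
    have "nrm i (A *v u) \<le> C * norm (A *v u)" using A u by (intro C) (auto simp: maps_block_def)
    also have "\<dots> \<le> C * (onorm ((*v) A) * norm u)"
      using C(1) by (intro mult_left_mono onorm) (auto simp: matrix_vector_mul_bounded_linear)
    also have "\<dots> \<le> C * (onorm ((*v) A) * C)"
      using C(1) C(3)[of u j] u
      by (intro mult_left_mono) (auto intro!: onorm_pos_le simp: matrix_vector_mul_bounded_linear)
    finally show "nrm i (A *v u) \<le> C * (onorm ((*v) A) * C)" .
  qed
  have pos: "nrm j v > 0" using nrm_nonneg[OF v] nrm_eq_0[OF v] False by linarith
  let ?u = "(1 / nrm j v) *\<^sub>R v"
  have "?u \<in> ?S" using v pos by (simp add: block_space_scaleR nrm_scaleR)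
  then have "nrm i (A *v ?u) \<le> mixed_norm blk nrm i j A"
    unfolding mixed_norm_def by (rule cSUP_upper[OF _ bdd])
  moreover have "nrm i (A *v ?u) = nrm i (A *v v) / nrm j v"
    using A v pos by (simp add: matrix_vector_mult_scaleR nrm_scaleR maps_block_def)
  ultimately show ?thesis using pos by (simp add: field_simps)
qed

lemma mixed_norm_le:
  assumes "\<And>v. v \<in> block_space blk j \<Longrightarrow> nrm i (A *v v) \<le> c * nrm j v"
  shows "mixed_norm blk nrm i j A \<le> c"
  unfolding mixed_norm_def
proof (rule cSUP_least)
  show "{v \<in> block_space blk j. nrm j v = 1} \<noteq> {}" using unit_sphere_nonempty by blast
qed (use assms in fastforce)

lemma mixed_norm_nonneg:
  assumes "maps_block i j A" shows "mixed_norm blk nrm i j A \<ge> 0"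
proof -
  obtain v where v: "v \<in> block_space blk j" "nrm j v = 1" using unit_sphere_nonempty by blast
  have "0 \<le> nrm i (A *v v)" using assms v by (intro nrm_nonneg) (simp add: maps_block_def)
  then show ?thesis using nrm_mult_le[OF assms v(1)] v(2) by simp
qed

lemma mixed_norm_combine:
  assumes A: "maps_block i j A" and B: "maps_block i j B"
  shows "mixed_norm blk nrm i j (s *\<^sub>R A + t *\<^sub>R B) \<le>
    \<bar>s\<bar> * mixed_norm blk nrm i j A + \<bar>t\<bar> * mixed_norm blk nrm i j B"
proof (rule mixed_norm_le)
  fix v assume v: "v \<in> block_space blk j"
  have Av: "A *v v \<in> block_space blk i" "B *v v \<in> block_space blk i"
    using A B v by (auto simp: maps_block_def)
  have "(s *\<^sub>R A + t *\<^sub>R B) *v v = s *\<^sub>R (A *v v) + t *\<^sub>R (B *v v)"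
    by (simp add: matrix_vector_mult_add_rdistrib scaleR_matrix_vector_assoc)
  then have "nrm i ((s *\<^sub>R A + t *\<^sub>R B) *v v) \<le> \<bar>s\<bar> * nrm i (A *v v) + \<bar>t\<bar> * nrm i (B *v v)"
    using nrm_add[OF Av[THEN block_space_scaleR], of s t] Av by (simp add: nrm_scaleR)
  also have "\<dots> \<le> \<bar>s\<bar> * (mixed_norm blk nrm i j A * nrm j v) + \<bar>t\<bar> * (mixed_norm blk nrm i j B * nrm j v)"
    using A B v by (intro add_mono mult_left_mono nrm_mult_le) auto
  finally show "nrm i ((s *\<^sub>R A + t *\<^sub>R B) *v v) \<le>
      (\<bar>s\<bar> * mixed_norm blk nrm i j A + \<bar>t\<bar> * mixed_norm blk nrm i j B) * nrm j v"
    by (simp add: algebra_simps)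
qed

lemma mixed_norm_mat_1: "mixed_norm blk nrm i i (mat 1) = 1"
proof (rule antisym)
  show "mixed_norm blk nrm i i (mat 1) \<le> 1" by (rule mixed_norm_le) simp
  obtain v where v: "v \<in> block_space blk i" "nrm i v = 1" using unit_sphere_nonempty by blast
  show "1 \<le> mixed_norm blk nrm i i (mat 1)" using nrm_mult_le[OF maps_block_mat_1 v(1)] v(2) by simp
qed

section \<open>Matrix measures as monotone limits of difference quotients\<close>

definition measure_quotient :: "'m \<Rightarrow> real ^ 'n ^ 'n \<Rightarrow> real \<Rightarrow> real" where
  "measure_quotient i A t = (mixed_norm blk nrm i i (mat 1 + t *\<^sub>R A) - 1) / t"

text \<open>Convexity: mat 1 + s A is the convex combination with weights s / t and 1 - s / t of mat
  1 + t A and mat 1, and the latter has norm 1.\<close>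

lemma measure_quotient_mono:
  assumes A: "maps_block i i A" and st: "0 < s" "s \<le> t"
  shows "measure_quotient i A s \<le> measure_quotient i A t"
proof -
  let ?M = "mat 1 + t *\<^sub>R A"
  have M: "maps_block i i ?M" using maps_block_combine[OF maps_block_mat_1 A, of 1 t] by simp
  have "mat 1 + s *\<^sub>R A = (s / t) *\<^sub>R ?M + (1 - s / t) *\<^sub>R mat 1"
    using st by (simp add: algebra_simps)
  then have "mixed_norm blk nrm i i (mat 1 + s *\<^sub>R A) \<le> s / t * mixed_norm blk nrm i i ?M + (1 - s / t)"
    using mixed_norm_combine[OF M maps_block_mat_1, of "s / t" "1 - s / t"] st
    by (simp add: mixed_norm_mat_1)
  then have "mixed_norm blk nrm i i (mat 1 + s *\<^sub>R A) - 1 \<le> s / t * (mixed_norm blk nrm i i ?M - 1)"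
    by (simp add: algebra_simps)
  then have "(mixed_norm blk nrm i i (mat 1 + s *\<^sub>R A) - 1) / s \<le> s / t * (mixed_norm blk nrm i i ?M - 1) / s"
    using st by (intro divide_right_mono) auto
  then show ?thesis using st by (simp add: measure_quotient_def)
qed

text \<open>Triangle inequality for mat 1 = (mat 1 + t A) - t A.\<close>

lemma measure_quotient_ge:
  assumes A: "maps_block i i A" and t: "0 < t"
  shows "- mixed_norm blk nrm i i A \<le> measure_quotient i A t"
proof -
  let ?M = "mat 1 + t *\<^sub>R A"
  have M: "maps_block i i ?M" using maps_block_combine[OF maps_block_mat_1 A, of 1 t] by simp
  have "mixed_norm blk nrm i i (mat 1) \<le> mixed_norm blk nrm i i ?M + t * mixed_norm blk nrm i i A"
    using mixed_norm_combine[OF M A, of 1 "- t"] t by simp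
  then show ?thesis using t by (simp add: measure_quotient_def mixed_norm_mat_1 field_simps)
qed

text \<open>Being monotone in t and bounded below, the quotients converge to their infimum; thus the
  \<open>Lim\<close> defining the measure is a genuine limit.\<close>

lemma matrix_measure_tendsto:
  assumes A: "maps_block i i A"
  shows "(measure_quotient i A \<longlongrightarrow> matrix_measure blk nrm i A) (at_right 0)"
proof -
  let ?l = "INF t\<in>{0<..}. measure_quotient i A t"
  have bdd: "bdd_below (measure_quotient i A ` {0<..})"
    using measure_quotient_ge[OF A] by (intro bdd_belowI2) auto
  have "(measure_quotient i A \<longlongrightarrow> ?l) (at_right 0)"
  proof (rule order_tendstoI)
    fix a assume a: "a < ?l"
    have "a < measure_quotient i A t" if "t > 0" for t
      using cINF_lower[OF bdd, of t] that a by simp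
    then show "eventually (\<lambda>t. a < measure_quotient i A t) (at_right 0)"
      using eventually_at_right_less[of "0::real"] by (auto elim: eventually_mono)
  next
    fix a assume "?l < a"
    then obtain t where t: "t > 0" "measure_quotient i A t < a"
      using cINF_less_iff[OF _ bdd, of a] by auto
    have "eventually (\<lambda>s. s \<in> {0<..<t}) (at_right 0)" using t by (intro eventually_at_right_real)
    then show "eventually (\<lambda>s. measure_quotient i A s < a) (at_right 0)"
    proof eventually_elim
      case (elim s) then show ?case using measure_quotient_mono[OF A, of s t] t by simp
    qed
  qed
  moreover from tendsto_Lim[OF _ this] have "matrix_measure blk nrm i A = ?l"
    by (simp add: matrix_measure_def measure_quotient_def[abs_def])
  ultimately show ?thesis by simp
qed

text \<open>Each difference quotient is convex in the matrix, since mat 1 is the same convex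
  combination of itself; the inequality survives the limit.\<close>

lemma matrix_measure_convex:
  assumes A: "maps_block i i A" and B: "maps_block i i B" and uv: "u \<ge> 0" "v \<ge> 0" "u + v = 1"
  shows "matrix_measure blk nrm i (u *\<^sub>R A + v *\<^sub>R B) \<le>
    u * matrix_measure blk nrm i A + v * matrix_measure blk nrm i B"
proof (rule tendsto_le)
  show "(measure_quotient i (u *\<^sub>R A + v *\<^sub>R B) \<longlongrightarrow> matrix_measure blk nrm i (u *\<^sub>R A + v *\<^sub>R B)) (at_right 0)"
    by (intro matrix_measure_tendsto maps_block_combine A B)
  show "((\<lambda>t. u * measure_quotient i A t + v * measure_quotient i B t) \<longlongrightarrow>
      u * matrix_measure blk nrm i A + v * matrix_measure blk nrm i B) (at_right 0)"
    by (intro tendsto_intros matrix_measure_tendsto A B)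
  have "measure_quotient i (u *\<^sub>R A + v *\<^sub>R B) t \<le> u * measure_quotient i A t + v * measure_quotient i B t"
    if t: "t > 0" for t
  proof -
    let ?M = "\<lambda>A. mat 1 + t *\<^sub>R A :: real ^ 'n ^ 'n"
    have M: "maps_block i i (?M A)" if "maps_block i i A" for A
      using maps_block_combine[OF maps_block_mat_1 that, of 1 t] by simp
    have "u *\<^sub>R mat 1 + v *\<^sub>R mat 1 = (mat 1 :: real ^ 'n ^ 'n)"
      using uv by (metis scaleR_left.add scaleR_one)
    then have "?M (u *\<^sub>R A + v *\<^sub>R B) = u *\<^sub>R ?M A + v *\<^sub>R ?M B"
      by (simp add: algebra_simps)
    then have "mixed_norm blk nrm i i (?M (u *\<^sub>R A + v *\<^sub>R B)) \<le>
        u * mixed_norm blk nrm i i (?M A) + v * mixed_norm blk nrm i i (?M B)"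
      using mixed_norm_combine[OF M[OF A] M[OF B], of u v] uv by simp
    then have "mixed_norm blk nrm i i (?M (u *\<^sub>R A + v *\<^sub>R B)) - 1 \<le>
        u * (mixed_norm blk nrm i i (?M A) - 1) + v * (mixed_norm blk nrm i i (?M B) - 1)"
      using uv by (simp add: algebra_simps)
    then have "(mixed_norm blk nrm i i (?M (u *\<^sub>R A + v *\<^sub>R B)) - 1) / t \<le>
        (u * (mixed_norm blk nrm i i (?M A) - 1) + v * (mixed_norm blk nrm i i (?M B) - 1)) / t"
      using t by (intro divide_right_mono) auto
    then show ?thesis by (simp add: measure_quotient_def add_divide_distrib)
  qed
  then show "eventually (\<lambda>t. measure_quotient i (u *\<^sub>R A + v *\<^sub>R B) t \<le>
      u * measure_quotient i A t + v * measure_quotient i B t) (at_right 0)"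
    using eventually_at_right_less[of "0::real"] by (auto elim: eventually_mono)
qed simp

section \<open>Interconnection matrices and the growth of the weighted norm\<close>

definition interconnection :: "real ^ 'n ^ 'n \<Rightarrow> real ^ 'm ^ 'm" where
  "interconnection A = (\<chi> i j. if i = j then matrix_measure blk nrm i (submat blk i i A)
                                else mixed_norm blk nrm i j (submat blk i j A))"

text \<open>A mean value matrix A(t) need not be the Jacobian at any single point, so
  \<open>interconnection\<close> takes an arbitrary matrix; convexity carries a bound from the
  Jacobians to their convex hull.\<close>

lemma convex_interconnection_le: "convex {A. \<forall>i j. interconnection A $ i $ j \<le> B $ i $ j}"
proof (rule convexI)
  fix X Y :: "real ^ 'n ^ 'n" and u v :: real
  assume X: "X \<in> {A. \<forall>i j. interconnection A $ i $ j \<le> B $ i $ j}"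
    and Y: "Y \<in> {A. \<forall>i j. interconnection A $ i $ j \<le> B $ i $ j}"
    and uv: "u \<ge> 0" "v \<ge> 0" "u + v = 1"
  have "interconnection (u *\<^sub>R X + v *\<^sub>R Y) $ i $ j \<le> B $ i $ j" for i j
  proof -
    have "interconnection (u *\<^sub>R X + v *\<^sub>R Y) $ i $ j \<le>
        u * interconnection X $ i $ j + v * interconnection Y $ i $ j"
    proof (cases "i = j")
      case True
      then show ?thesis
        using matrix_measure_convex[of j "submat blk j j X" "submat blk j j Y" u v, OF maps_block_submat maps_block_submat uv]
        by (simp add: interconnection_def submat_add submat_scaleR)
    next
      case False
      then show ?thesis
        using mixed_norm_combine[of i j "submat blk i j X" "submat blk i j Y" u v, OF maps_block_submat maps_block_submat] uv
        by (simp add: interconnection_def submat_add submat_scaleR)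
    qed
    also have "\<dots> \<le> u * B $ i $ j + v * B $ i $ j"
      using X Y uv by (intro add_mono mult_left_mono) auto
    also have "\<dots> = B $ i $ j" using uv(3) by (metis distrib_right mult_1)
    finally show ?thesis .
  qed
  then show "u *\<^sub>R X + v *\<^sub>R Y \<in> {A. \<forall>i j. interconnection A $ i $ j \<le> B $ i $ j}" by simp
qed

text \<open>In block i the diagonal part multiplies the norm by at most 1 + h b, with b slightly
  above the measure, while the other blocks contribute through their mixed norms. Bounding each
  block norm by w_j V gives w_i V + h V (B w)_i plus a small error, and B w \<le> c w
  finishes.\<close>

lemma wnorm_infinitesimal_growth:
  assumes w: "\<And>i. w $ i > 0" and Bw: "\<And>i. (B *v w) $ i \<le> c * w $ i"
    and AB: "\<And>i j. interconnection A $ i $ j \<le> B $ i $ j" and \<epsilon>: "\<epsilon> > 0"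
  shows "eventually (\<lambda>h. wnorm w (v + h *\<^sub>R (A *v v)) \<le> wnorm w v + h * (c * wnorm w v + \<epsilon>)) (at_right 0)"
proof -
  define V where "V = wnorm w v"
  \<comment> \<open>The excess \<delta> of b over the bound on the measure costs h \<delta> V after
    division by w_i; V + 1 avoids dividing by 0.\<close>
  define \<delta> where "\<delta> = \<epsilon> / (V + 1)"
  have nn: "V \<ge> 0" using norm_on_wnorm[OF w] by (simp add: norm_on_def V_def)
  have \<delta>: "\<delta> > 0" "\<delta> * V \<le> \<epsilon>" using nn \<epsilon> by (auto simp: \<delta>_def field_simps)
  define z where "z = (\<lambda>i. nrm i (block_proj blk i v))"
  have z: "0 \<le> z i" "z i \<le> w $ i * V" for i
    using wnorm_ge[of i v w] w[of i] by (auto simp: z_def V_def nrm_nonneg block_proj_in field_simps)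
  have "eventually (\<lambda>h. \<forall>i. nrm i (block_proj blk i (v + h *\<^sub>R (A *v v))) / w $ i \<le> V + h * (c * V + \<epsilon>)) (at_right 0)"
  proof (rule eventually_all_finite)
    fix i
    define b where "b = B $ i $ i + \<delta>"
    define D where "D = submat blk i i A"
    have "matrix_measure blk nrm i D < b" using AB[of i i] \<delta> by (simp add: interconnection_def b_def D_def)
    then have "eventually (\<lambda>h. measure_quotient i D h < b) (at_right 0)"
      using matrix_measure_tendsto[of i D] maps_block_submat unfolding D_def by (intro order_tendstoD) auto
    \<comment> \<open>As b may be negative, h must be small for 1 + h b to be nonnegative; only then
      may the block norm be replaced by its upper bound w_i V.\<close>
    moreover have "eventually (\<lambda>h. h \<in> {0<..<1 / (\<bar>b\<bar> + 1)}) (at_right (0::real))"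
      by (intro eventually_at_right_real) simp
    ultimately show "eventually (\<lambda>h. nrm i (block_proj blk i (v + h *\<^sub>R (A *v v))) / w $ i \<le> V + h * (c * V + \<epsilon>)) (at_right 0)"
    proof eventually_elim
      case (elim h)
      have h: "h > 0" "h * (\<bar>b\<bar> + 1) \<le> 1" using elim(2) by (auto simp: field_simps)
      have "- (h * b) \<le> h * (\<bar>b\<bar> + 1)" using h(1) by (metis abs_ge_minus_self add_increasing2 less_imp_le mult_left_mono mult_minus_right zero_le_one)
      then have hb: "1 + h * b \<ge> 0" using h(2) by linarith
      have M: "maps_block i i (mat 1 + h *\<^sub>R D)"
        using maps_block_combine[of i i "mat 1" D 1 h] by (simp add: D_def maps_block_mat_1 maps_block_submat)
      have "mixed_norm blk nrm i i (mat 1 + h *\<^sub>R D) \<le> 1 + h * b"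
        using elim(1) h(1) by (simp add: measure_quotient_def field_simps)
      let ?g = "\<lambda>j. submat blk i j A *v block_proj blk j v"
      have g: "?g j \<in> block_space blk i" for j
        by (simp add: submat_mult block_proj_in)
      have "block_proj blk i (v + h *\<^sub>R (A *v v)) = block_proj blk i v + h *\<^sub>R (\<Sum>j\<in>UNIV. ?g j)"
        by (simp add: block_proj_add block_proj_scaleR block_proj_matrix_mult)
      also have "(\<Sum>j\<in>UNIV. ?g j) = ?g i + (\<Sum>j\<in>UNIV - {i}. ?g j)"
        by (rule sum.remove) auto
      finally have "block_proj blk i (v + h *\<^sub>R (A *v v)) =
          (mat 1 + h *\<^sub>R D) *v block_proj blk i v + h *\<^sub>R (\<Sum>j\<in>UNIV - {i}. ?g j)"
        by (simp add: D_def matrix_vector_mult_add_rdistrib scaleR_matrix_vector_assoc scaleR_add_right)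
      then have "nrm i (block_proj blk i (v + h *\<^sub>R (A *v v))) \<le>
          nrm i ((mat 1 + h *\<^sub>R D) *v block_proj blk i v) + nrm i (h *\<^sub>R (\<Sum>j\<in>UNIV - {i}. ?g j))"
        using M nrm_sum[of "UNIV - {i}" ?g i] g
        by (auto intro!: nrm_add block_space_scaleR simp: maps_block_def block_proj_in)
      also have "nrm i ((mat 1 + h *\<^sub>R D) *v block_proj blk i v) \<le> (1 + h * b) * z i"
        using nrm_mult_le[OF M block_proj_in, of v] \<open>mixed_norm _ _ _ _ _ \<le> _\<close> z(1)[of i]
        by (auto simp: z_def intro: order_trans mult_right_mono)
      also have "(1 + h * b) * z i \<le> (1 + h * b) * (w $ i * V)"
        by (intro mult_left_mono z hb)
      also have "nrm i (h *\<^sub>R (\<Sum>j\<in>UNIV - {i}. ?g j)) = h * nrm i (\<Sum>j\<in>UNIV - {i}. ?g j)"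
        using nrm_sum[of "UNIV - {i}" ?g i] g h by (simp add: nrm_scaleR)
      also have "h * nrm i (\<Sum>j\<in>UNIV - {i}. ?g j) \<le> h * (\<Sum>j\<in>UNIV - {i}. B $ i $ j * (w $ j * V))"
      proof (rule mult_left_mono)
        have "nrm i (?g j) \<le> B $ i $ j * (w $ j * V)" if "j \<in> UNIV - {i}" for j
        proof -
          have 1: "0 \<le> mixed_norm blk nrm i j (submat blk i j A)"
            "mixed_norm blk nrm i j (submat blk i j A) \<le> B $ i $ j"
            using that AB[of i j] by (auto simp: interconnection_def mixed_norm_nonneg maps_block_submat)
          have "nrm i (?g j) \<le> mixed_norm blk nrm i j (submat blk i j A) * z j"
            unfolding z_def by (intro nrm_mult_le maps_block_submat block_proj_in)
          also have "\<dots> \<le> B $ i $ j * (w $ j * V)"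
            using 1 z[of j] by (intro mult_mono) auto
          finally show ?thesis .
        qed
        then have "(\<Sum>j\<in>UNIV - {i}. nrm i (?g j)) \<le> (\<Sum>j\<in>UNIV - {i}. B $ i $ j * (w $ j * V))"
          by (rule sum_mono)
        then show "nrm i (\<Sum>j\<in>UNIV - {i}. ?g j) \<le> (\<Sum>j\<in>UNIV - {i}. B $ i $ j * (w $ j * V))"
          using nrm_sum[of "UNIV - {i}" ?g i] g by auto
      qed (use h in simp)
      also have "(1 + h * b) * (w $ i * V) + h * (\<Sum>j\<in>UNIV - {i}. B $ i $ j * (w $ j * V)) =
          w $ i * V + h * (\<delta> * V) * w $ i + h * ((B *v w) $ i * V)"
      proof -
        have "(B *v w) $ i * V = (\<Sum>j\<in>UNIV. B $ i $ j * (w $ j * V))"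
          by (simp add: matrix_vector_mult_def sum_distrib_right mult.assoc)
        also have "\<dots> = B $ i $ i * (w $ i * V) + (\<Sum>j\<in>UNIV - {i}. B $ i $ j * (w $ j * V))"
          by (rule sum.remove) auto
        finally show ?thesis by (simp add: b_def algebra_simps)
      qed
      also have "\<dots> \<le> w $ i * V + h * \<epsilon> * w $ i + h * (c * w $ i * V)"
        using h(1) \<delta>(2) Bw[of i] nn w[of i]
        by (intro add_mono mult_right_mono mult_left_mono order_refl) auto
      finally have "nrm i (block_proj blk i (v + h *\<^sub>R (A *v v))) \<le> (V + h * (c * V + \<epsilon>)) * w $ i"
        by (simp add: algebra_simps)
      then show ?case using w[of i] by (simp add: pos_divide_le_eq)
    qed
  qed
  then show ?thesis by (simp add: wnorm_le_iff V_def)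
qed

lemma wnorm_growth:
  assumes ab: "a \<le> b" and cont: "continuous_on {a..b} e" and S: "countable S"
    and w: "\<And>i. w $ i > 0" and Bw: "\<And>i. (B *v w) $ i \<le> c * w $ i"
    and deriv: "\<And>t. t \<in> {a..<b} - S \<Longrightarrow>
      \<exists>A. (e has_vector_derivative A *v e t) (at t within {t..}) \<and>
          (\<forall>i j. interconnection A $ i $ j \<le> B $ i $ j)"
  shows "wnorm w (e b) \<le> exp (c * (b - a)) * wnorm w (e a)"
proof (rule dini_gronwall[OF ab _ S])
  have no: "norm_on UNIV (wnorm w)" by (rule norm_on_wnorm[OF w])
  show "continuous_on {a..b} (\<lambda>t. wnorm w (e t))"
    using continuous_on_compose[OF cont norm_on_UNIV_continuous[OF no]] by (simp add: o_def)
  obtain C where C: "C > 0" "\<And>v. wnorm w v \<le> C * norm v" using norm_on_UNIV_bound[OF no] by blast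
  fix t \<epsilon> assume t: "t \<in> {a..<b} - S" and \<epsilon>: "(\<epsilon>::real) > 0"
  obtain A where A: "(e has_vector_derivative A *v e t) (at t within {t..})"
    "\<And>i j. interconnection A $ i $ j \<le> B $ i $ j" using deriv[OF t] by blast
  let ?V = "wnorm w (e t)"
  have "eventually (\<lambda>h. wnorm w (e t + h *\<^sub>R (A *v e t)) \<le> ?V + h * (c * ?V + \<epsilon> / 2)) (at_right 0)"
    using \<epsilon> by (intro wnorm_infinitesimal_growth[OF w Bw A(2)]) auto
  then have "eventually (\<lambda>s. wnorm w (e t + (s - t) *\<^sub>R (A *v e t)) \<le> ?V + (s - t) * (c * ?V + \<epsilon> / 2)) (at_right t)"
    by (simp add: eventually_at_right_to_0[of _ t])
  \<comment> \<open>C converts the Euclidean remainder into the weighted norm, where it uses up the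
    other half of \<epsilon>.\<close>
  moreover have "eventually (\<lambda>s. norm (e s - e t - (s - t) *\<^sub>R (A *v e t)) \<le> \<epsilon> / (2 * C) * (s - t)) (at_right t)"
    using \<epsilon> C(1) by (intro has_vector_derivative_right_remainder[OF A(1)]) auto
  ultimately show "eventually (\<lambda>s. wnorm w (e s) \<le> ?V + (s - t) * (c * ?V + \<epsilon>)) (at_right t)"
  proof eventually_elim
    case (elim s)
    let ?r = "e s - e t - (s - t) *\<^sub>R (A *v e t)"
    have decomp: "e s = e t + (s - t) *\<^sub>R (A *v e t) + ?r" by simp
    have "wnorm w (e t + (s - t) *\<^sub>R (A *v e t) + ?r) \<le> wnorm w (e t + (s - t) *\<^sub>R (A *v e t)) + wnorm w ?r"
      using no unfolding norm_on_def by blast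
    moreover have "wnorm w ?r \<le> C * (\<epsilon> / (2 * C) * (s - t))"
      using C(2)[of ?r] mult_left_mono[OF elim(2), of C] C(1) by linarith
    moreover have "C * (\<epsilon> / (2 * C) * (s - t)) = \<epsilon> / 2 * (s - t)" using C(1) by simp
    ultimately have "wnorm w (e s) \<le> ?V + (s - t) * (c * ?V + \<epsilon> / 2) + \<epsilon> / 2 * (s - t)"
      unfolding decomp[symmetric] using elim(1) by linarith
    also have "\<dots> = ?V + (s - t) * (c * ?V + \<epsilon>)" by (simp add: algebra_simps)
    finally show ?case .
  qed
qed

end

text \<open>If no such A existed, a hyperplane would separate g x - g y from the compact convex set of all
  A (x - y), contradicting the scalar mean value theorem for the separating functional.\<close>

lemma mean_value_jacobian:
  fixes g :: "real ^ 'n \<Rightarrow> real ^ 'n"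
  assumes diff: "\<And>v. g differentiable at v"
    and cont: "continuous_on UNIV (\<lambda>v. jacobian g (at v))"
  obtains A where "A \<in> convex hull ((\<lambda>v. jacobian g (at v)) ` closed_segment x y)"
    "g x - g y = A *v (x - y)"
proof -
  let ?M = "convex hull ((\<lambda>v. jacobian g (at v)) ` closed_segment x y)"
  let ?S = "(\<lambda>A. A *v (x - y)) ` ?M"
  have lin: "linear (\<lambda>A :: real ^ 'n ^ 'n. A *v (x - y))"
    by (rule linearI) (simp_all add: matrix_vector_mult_add_rdistrib scaleR_matrix_vector_assoc)
  have "compact ?M"
    by (intro compact_convex_hull compact_continuous_image compact_segment continuous_on_subset[OF cont]) simp
  then have "compact ?S"
    by (intro compact_continuous_image linear_continuous_on linear_conv_bounded_linear[THEN iffD1] lin)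
  then have "closed ?S" by (rule compact_imp_closed)
  have "convex ?S" by (intro convex_linear_image[OF lin] convex_convex_hull)
  have "g x - g y \<in> ?S"
  proof (rule ccontr)
    assume "g x - g y \<notin> ?S"
    then obtain a b where ab: "a \<bullet> (g x - g y) < b" "\<And>u. u \<in> ?S \<Longrightarrow> b < a \<bullet> u"
      using separating_hyperplane_closed_point[OF \<open>convex ?S\<close> \<open>closed ?S\<close>] by metis
    define p where "p = (\<lambda>s. y + s *\<^sub>R (x - y))"
    have "((\<lambda>s. a \<bullet> g (p s)) has_derivative (\<lambda>h. a \<bullet> (jacobian g (at (p s)) *v (h *\<^sub>R (x - y))))) (at s within {0..1})" for s
    proof -
      have "(p has_derivative (\<lambda>h. h *\<^sub>R (x - y))) (at s within {0..1})"
        unfolding p_def by (auto intro!: derivative_eq_intros)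
      moreover have "(g has_derivative (\<lambda>h. jacobian g (at (p s)) *v h)) (at (p s))"
        using diff jacobian_works by blast
      ultimately show ?thesis
        by (intro has_derivative_inner_right has_derivative_compose[where f = p and g = g])
    qed
    then obtain s where s: "s \<in> {0<..<1}"
      "a \<bullet> g (p 1) - a \<bullet> g (p 0) = a \<bullet> (jacobian g (at (p s)) *v ((1 - 0) *\<^sub>R (x - y)))"
      using mvt_simple[of 0 1 "\<lambda>s. a \<bullet> g (p s)" "\<lambda>s h. a \<bullet> (jacobian g (at (p s)) *v (h *\<^sub>R (x - y)))"]
      by auto
    \<comment> \<open>The path p runs from y to x, against the parametrization of the segment, hence
      the witness 1 - s.\<close>
    have "p s \<in> closed_segment x y"
      using s(1) unfolding closed_segment_def p_def
      by (auto intro!: exI[of _ "1 - s"] simp: algebra_simps)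
    then have "jacobian g (at (p s)) *v (x - y) \<in> ?S" by (intro imageI hull_inc)
    from ab(2)[OF this] show False using s(2) ab(1) by (simp add: p_def inner_diff_right)
  qed
  then show thesis using that by blast
qed

section \<open>Metzler matrices\<close>

lemma mat_vector_mult: "(mat z :: 'a :: comm_semiring_1 ^ 'n ^ 'n) *v v = z *s v"
  by (simp add: vec_eq_iff matrix_vector_mult_def mat_def if_distrib if_distribR cong del: if_weak_cong)

text \<open>Eigenvalues are the roots of the characteristic polynomial, which is nonzero because
  some explicit large number is not a root. Finiteness is what makes the \<open>Max\<close> in
  \<open>lambda_max\<close> an upper bound.\<close>

lemma finite_eigenvalues: "finite (eigenvalues (M :: real ^ 'm ^ 'm))"
proof -
  let ?M = "map_matrix complex_of_real M"
  \<comment> \<open>The matrix X I - M over the polynomial ring.\<close>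
  define P :: "complex poly ^ 'm ^ 'm" where
    "P = (\<chi> i j. if i = j then [:- ?M $ i $ j, 1:] else [:- ?M $ i $ j:])"
  have det_P: "poly (det P) z = det (mat z - ?M)" for z
    unfolding det_def poly_sum
    by (rule sum.cong)
      (auto simp: poly_prod P_def mat_def intro!: prod.cong)
  have eig: "poly (det P) z = 0" if z: "z \<in> eigenvalues M" for z
  proof -
    obtain v where v: "v \<noteq> 0" "?M *v v = z *s v"
      using z unfolding eigenvalues_def by blast
    then have "(mat z - ?M) *v v = 0"
      by (simp add: mat_vector_mult matrix_vector_mult_diff_rdistrib)
    then have "\<not> invertible (mat z - ?M)"
      using v(1) by (metis invertible_def matrix_left_invertible_ker)
    then show ?thesis by (simp add: det_P invertible_det_nz)
  qed
  \<comment> \<open>Exceeds every absolute row sum by at least 1; the eigenvalue equation for s then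
    fails in the row of an entry of v of largest modulus.\<close>
  define s where "s = (\<Sum>i\<in>UNIV. \<Sum>j\<in>UNIV. norm (?M $ i $ j)) + 1"
  have "complex_of_real s \<notin> eigenvalues M"
  proof
    assume "complex_of_real s \<in> eigenvalues M"
    then obtain v where v: "v \<noteq> 0" "?M *v v = complex_of_real s *s v"
      unfolding eigenvalues_def by blast
    have s: "s > 0" unfolding s_def by (simp add: add_nonneg_pos sum_nonneg)
    define B where "B = Max (range (\<lambda>j. norm (v $ j)))"
    have B: "norm (v $ j) \<le> B" for j unfolding B_def by (rule Max_ge) auto
    obtain i where i: "norm (v $ i) = B"
    proof -
      have "B \<in> range (\<lambda>j. norm (v $ j))" unfolding B_def by (rule Max_in) auto
      then show ?thesis using that by auto
    qed
    have "B > 0" using v(1) B by (metis norm_le_zero_iff not_le vec_eq_iff zero_index order_trans)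
    have "s * B = norm ((?M *v v) $ i)"
      using v(2) i s by (simp add: norm_mult)
    also have "\<dots> \<le> (\<Sum>j\<in>UNIV. norm (?M $ i $ j) * norm (v $ j))"
      unfolding matrix_vector_mult_def by (simp add: sum_norm_le norm_mult)
    also have "\<dots> \<le> (\<Sum>j\<in>UNIV. norm (?M $ i $ j)) * B"
      unfolding sum_distrib_right by (intro sum_mono mult_left_mono B) auto
    also have "\<dots> \<le> (s - 1) * B"
      unfolding s_def
      using \<open>B > 0\<close> member_le_sum[of i UNIV "\<lambda>i. \<Sum>j\<in>UNIV. norm (?M $ i $ j)"]
      by (intro mult_right_mono) (auto simp: sum_nonneg)
    finally show False using \<open>B > 0\<close> by (simp add: algebra_simps)
  qed
  moreover have "z \<in> eigenvalues M" if "poly (det P) z = 0" for z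
  proof -
    have "\<not> invertible (mat z - ?M)" using that by (simp add: det_P invertible_det_nz)
    then obtain v where v: "v \<noteq> 0" "(mat z - ?M) *v v = 0"
      by (metis invertible_left_inverse matrix_left_invertible_ker)
    then show ?thesis
      unfolding eigenvalues_def by (auto simp: mat_vector_mult matrix_vector_mult_diff_rdistrib)
  qed
  ultimately have "det P \<noteq> 0" by force
  then show ?thesis
    using eig by (intro finite_subset[OF _ poly_roots_finite]) auto
qed

lemma real_eigenvalue_le_lambda_max:
  fixes M :: "real ^ 'm ^ 'm"
  assumes "M *v v = s *\<^sub>R v" and "v \<noteq> 0"
  shows "s \<le> lambda_max M"
proof -
  let ?v = "\<chi> i. complex_of_real (v $ i)"
  have "map_matrix complex_of_real M *v ?v = complex_of_real s *s ?v"
  proof -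
    have "(\<Sum>j\<in>UNIV. M $ i $ j * v $ j) = s * v $ i" for i
      using arg_cong[OF assms(1), of "\<lambda>x. x $ i"] by (simp add: matrix_vector_mult_def)
    then have "(\<Sum>j\<in>UNIV. complex_of_real (M $ i $ j) * complex_of_real (v $ j)) =
        complex_of_real s * complex_of_real (v $ i)" for i
      by (simp flip: of_real_mult of_real_sum)
    then show ?thesis by (simp add: vec_eq_iff matrix_vector_mult_def map_matrix_def)
  qed
  moreover have "?v \<noteq> 0" using assms(2) by (auto simp: vec_eq_iff)
  ultimately have "complex_of_real s \<in> eigenvalues M" unfolding eigenvalues_def by blast
  then show ?thesis
    unfolding lambda_max_def
    by (intro Max_ge) (auto simp: finite_eigenvalues intro: image_eqI[of _ _ "complex_of_real s"])
qed

text \<open>Minimum principle. At an index k minimizing x_k / w_k with value m, one has x \<ge> m w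
  with equality at k, so nonnegative off-diagonal entries give (M x)_k \<ge> m (M w)_k. For m < 0
  the right side exceeds m s w_k = s x_k, a contradiction.\<close>

lemma metzler_resolvent_nonneg:
  fixes M :: "real ^ 'm ^ 'm"
  assumes M: "metzler M" and w: "\<And>i. w $ i > 0" "\<And>i. (M *v w) $ i < s * w $ i"
    and x: "\<And>i. (M *v x) $ i \<le> s * x $ i"
  shows "x $ i \<ge> 0"
proof -
  define m where "m = Min (range (\<lambda>i. x $ i / w $ i))"
  have m: "m \<le> x $ j / w $ j" for j unfolding m_def by (rule Min_le) auto
  obtain k where k: "x $ k / w $ k = m"
  proof -
    have "m \<in> range (\<lambda>i. x $ i / w $ i)" unfolding m_def by (rule Min_in) auto
    then show ?thesis using that by auto
  qed
  have mx: "m * w $ j \<le> x $ j" for j using m[of j] w(1)[of j] by (simp add: field_simps)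
  have xk: "x $ k = m * w $ k" using k w(1)[of k] by (simp add: field_simps)
  have "m \<ge> 0"
  proof (rule ccontr)
    assume neg: "\<not> m \<ge> 0"
    have "M $ k $ j * (m * w $ j) \<le> M $ k $ j * x $ j" for j
      using M mx[of j] xk unfolding metzler_def by (cases "j = k") (auto intro: mult_left_mono)
    then have "(\<Sum>j\<in>UNIV. M $ k $ j * (m * w $ j)) \<le> (M *v x) $ k"
      unfolding matrix_vector_mult_def by (auto intro: sum_mono)
    also have "\<dots> \<le> s * x $ k" by (rule x)
    finally have "m * (M *v w) $ k \<le> m * (s * w $ k)"
      by (simp add: xk matrix_vector_mult_def sum_distrib_left algebra_simps)
    then show False using w(2)[of k] neg by (simp add: mult_le_cancel_left)
  qed
  then show ?thesis using mx[of i] w(1)[of i]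
    by (meson mult_nonneg_nonneg less_imp_le order_trans)
qed

text \<open>The set of s admitting such a w is open and upward closed; it is also closed in the
  half-line above the largest eigenvalue, as there a solution of (s I - M) w = 1 stays
  nonnegative in the limit.\<close>

lemma metzler_positive_supersolution:
  fixes M :: "real ^ 'm ^ 'm"
  assumes M: "metzler M" and c: "lambda_max M < c"
  obtains w :: "real ^ 'm" where "\<And>i. w $ i > 0" "\<And>i. (M *v w) $ i < c * w $ i"
proof -
  define G where "G = {s. \<exists>w :: real ^ 'm. (\<forall>i. w $ i > 0) \<and> (\<forall>i. (M *v w) $ i < s * w $ i)}"
  have up: "s' \<in> G" if s: "s \<in> G" and ss: "s \<le> s'" for s s'
  proof -
    obtain w where w: "\<And>i. w $ i > 0" "\<And>i. (M *v w) $ i < s * w $ i"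
      using s unfolding G_def by blast
    then have "(M *v w) $ i < s' * w $ i" for i
      using mult_right_mono[OF ss, of "w $ i"] w(1)[of i] w(2)[of i] by linarith
    then show ?thesis unfolding G_def using w(1) by blast
  qed
  have openG: "\<exists>s'<s. s' \<in> G" if s: "s \<in> G" for s
  proof -
    obtain w where w: "\<And>i. w $ i > 0" "\<And>i. (M *v w) $ i < s * w $ i"
      using s unfolding G_def by blast
    \<comment> \<open>The least s' with M w \<le> s' w (a Collatz-Wielandt quotient); the midpoint
      of s' and s restores strictness.\<close>
    define s' where "s' = Max (range (\<lambda>i. (M *v w) $ i / w $ i))"
    have "s' < s" using w by (simp add: s'_def field_simps)
    have le: "(M *v w) $ i \<le> s' * w $ i" for i
    proof -
      have "(M *v w) $ i / w $ i \<le> s'" unfolding s'_def by (rule Max_ge) auto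
      then show ?thesis using w(1)[of i] by (simp add: field_simps)
    qed
    have "(M *v w) $ i < (s' + s) / 2 * w $ i" for i
    proof -
      have "s' * w $ i < (s' + s) / 2 * w $ i"
        using \<open>s' < s\<close> w(1)[of i] by (intro mult_strict_right_mono) auto
      with le[of i] show ?thesis by simp
    qed
    with w(1) have "(s' + s) / 2 \<in> G" unfolding G_def by blast
    with \<open>s' < s\<close> show ?thesis by (intro exI[of _ "(s' + s) / 2"]) simp
  qed
  \<comment> \<open>Larger than every row sum, so the all-ones vector is a witness.\<close>
  define b where "b = (\<Sum>i\<in>UNIV. \<Sum>j\<in>UNIV. \<bar>M $ i $ j\<bar>) + 1"
  have bG: "b \<in> G"
  proof -
    have "(M *v 1) $ i < b * 1" for i
    proof -
      have "(M *v 1) $ i \<le> (\<Sum>j\<in>UNIV. \<bar>M $ i $ j\<bar>)"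
        unfolding matrix_vector_mult_def by (auto intro: sum_mono)
      also have "\<dots> \<le> b - 1"
        using member_le_sum[of i UNIV "\<lambda>i. \<Sum>j\<in>UNIV. \<bar>M $ i $ j\<bar>"] by (auto simp: b_def sum_nonneg)
      finally show ?thesis by simp
    qed
    then show ?thesis unfolding G_def by (auto intro!: exI[of _ 1])
  qed
  have "c \<in> G"
  proof (rule ccontr)
    assume cG: "c \<notin> G"
    have lower: "c \<le> s" if "s \<in> G" for s using up[OF that, of c] cG by linarith
    define s0 where "s0 = Inf G"
    have bdd: "bdd_below G" by (rule bdd_belowI) (rule lower)
    have s0c: "c \<le> s0" unfolding s0_def using bG by (intro cInf_greatest lower) auto
    have s0G: "s \<in> G" if "s0 < s" for s
      using cInf_lessD[of G s] bG that up unfolding s0_def by force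
    define R where "R = (\<lambda>s. mat s - M)"
    have R: "R s *v x = s *\<^sub>R x - M *v x" for s x
      by (simp add: R_def matrix_vector_mult_diff_rdistrib mat_vector_mult scalar_mult_eq_scaleR)
    \<comment> \<open>As s \<ge> s0 \<ge> c > \<open>lambda_max M\<close>, a nonzero kernel vector
      would belong to a real eigenvalue that is too large.\<close>
    have inv: "invertible (R s)" if "s \<ge> s0" for s
    proof -
      have "x = 0" if "R s *v x = 0" for x
        using real_eigenvalue_le_lambda_max[of M x s] that R[of s x] \<open>s \<ge> s0\<close> s0c c by force
      then show ?thesis by (metis invertible_left_inverse matrix_left_invertible_ker)
    qed
    obtain w where w: "R s0 *v w = 1"
      using inv[OF order_refl] by (metis invertible_def matrix_vector_mul_assoc matrix_vector_mul_lid)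
    have nonneg: "w $ i \<ge> 0" for i
    proof -
      \<comment> \<open>Small enough that \<eta> |w_i| \<le> 1 for all i; then (s0 + \<eta>) w - M w
        = 1 + \<eta> w is nonnegative, and the minimum principle applies at s0 + \<eta>, which lies
        in \<open>G\<close>.\<close>
      define \<eta> where "\<eta> = 1 / (\<Sum>i\<in>UNIV. \<bar>w $ i\<bar> + 1)"
      have S: "(\<Sum>i\<in>UNIV. \<bar>w $ i\<bar> + 1) > 0" by (intro sum_pos) auto
      then have \<eta>: "\<eta> > 0" by (simp add: \<eta>_def)
      obtain v where v: "\<And>i. v $ i > 0" "\<And>i. (M *v v) $ i < (s0 + \<eta>) * v $ i"
        using s0G[of "s0 + \<eta>"] \<eta> unfolding G_def by auto
      have "(M *v w) $ i \<le> (s0 + \<eta>) * w $ i" for i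
      proof -
        have "s0 * w $ i - (M *v w) $ i = 1"
          using arg_cong[OF w, of "\<lambda>x. x $ i"] by (simp add: R)
        moreover have "\<bar>w $ i\<bar> \<le> (\<Sum>i\<in>UNIV. \<bar>w $ i\<bar> + 1)"
          using member_le_sum[of i UNIV "\<lambda>i. \<bar>w $ i\<bar> + 1"] by force
        then have "\<eta> * \<bar>w $ i\<bar> \<le> 1" using S by (simp add: \<eta>_def)
        then have "\<bar>\<eta> * w $ i\<bar> \<le> 1" using \<eta> by (simp add: abs_mult)
        then have "- 1 \<le> \<eta> * w $ i" by linarith
        ultimately show ?thesis by (simp add: algebra_simps)
      qed
      then show ?thesis using metzler_resolvent_nonneg[OF M v] by blast
    qed
    have less: "(M *v w) $ i < s0 * w $ i" for i
      using arg_cong[OF w, of "\<lambda>x. x $ i"] by (simp add: R)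
    \<comment> \<open>If w_i = 0, the Metzler property and w \<ge> 0 give (M w)_i \<ge> 0, whereas
      (M w)_i = s0 w_i - 1 < 0.\<close>
    have "w $ i > 0" for i
    proof (rule ccontr)
      assume "\<not> w $ i > 0"
      then have wi: "w $ i = 0" using nonneg[of i] by simp
      have "(M *v w) $ i \<ge> 0"
        unfolding matrix_vector_mult_def
        using M nonneg wi by (auto simp: metzler_def intro!: sum_nonneg) (metis mult_nonneg_nonneg mult_zero_right order_refl)
      then show False using less[of i] wi by simp
    qed
    then have "s0 \<in> G" using less unfolding G_def by blast
    then obtain s' where "s' < s0" "s' \<in> G" using openG by blast
    then show False using cInf_lower[OF _ bdd] unfolding s0_def by force
  qed
  then show thesis using that unfolding G_def by blast
qed

section \<open>Spanning sets and entropy\<close>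

text \<open>Cut space into cubes of side r / n and keep one point of K per cube that meets K. The
  factor M is the same for all r, so r may shrink with the time horizon later.\<close>

lemma finite_cover_card:
  fixes K :: "(real ^ 'n) set"
  assumes K: "bounded K"
  obtains M where "M > 0"
    "\<forall>r\<in>{0<..1}. \<exists>E. finite E \<and> E \<subseteq> K \<and> (\<forall>x\<in>K. \<exists>y\<in>E. norm (x - y) < r) \<and>
      real (card E) \<le> M * (1 / r) ^ CARD('n)"
proof -
  obtain R where R: "R > 0" "\<And>x. x \<in> K \<Longrightarrow> norm x \<le> R" using K by (auto simp: bounded_pos)
  let ?n = "real CARD('n)"
  have n: "?n \<ge> 1" by (simp add: Suc_leI)
  \<comment> \<open>Each coordinate takes at most 2 m + 1 \<le> 2 n R / r + 3 cell indices, which is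
    at most B / r as r \<le> 1.\<close>
  define B where "B = 2 * ?n * R + 3"
  show thesis
  proof (rule that, rule_tac [2] ballI)
    show "B ^ CARD('n) > 0" using R(1) by (intro zero_less_power) (simp add: B_def add_pos_pos)
    fix r :: real assume "r \<in> {0<..1}"
    then have r: "0 < r" "r \<le> 1" by auto
    define cell where "cell = (\<lambda>(x :: real ^ 'n) k. \<lfloor>x $ k * (?n / r)\<rfloor>)"
    \<comment> \<open>The + 1 is for negative coordinates, whose floors lie up to one further from
      0.\<close>
    define m where "m = \<lfloor>R * (?n / r)\<rfloor> + 1"
    have m: "m \<ge> 0" using R n r by (simp add: m_def)
    have cells: "cell ` K \<subseteq> (UNIV \<rightarrow>\<^sub>E {- m..m})"
    proof
      fix g assume "g \<in> cell ` K"
      then obtain x where x: "x \<in> K" "g = cell x" by blast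
      have "g k \<in> {- m..m}" for k
      proof -
        have "\<bar>x $ k\<bar> * (?n / r) \<le> R * (?n / r)"
          using order_trans[OF component_le_norm_cart R(2)[OF x(1)]] n r
          by (intro mult_right_mono) auto
        then have "\<bar>x $ k * (?n / r)\<bar> \<le> R * (?n / r)" using r by (simp add: abs_mult)
        then have "\<lfloor>x $ k * (?n / r)\<rfloor> \<le> m" "- m \<le> \<lfloor>x $ k * (?n / r)\<rfloor>"
          unfolding m_def by linarith+
        then show ?thesis by (simp add: x(2) cell_def)
      qed
      then show "g \<in> UNIV \<rightarrow>\<^sub>E {- m..m}" by auto
    qed
    have fin: "finite (UNIV \<rightarrow>\<^sub>E {- m..m} :: ('n \<Rightarrow> int) set)" by (intro finite_PiE) auto
    define E where "E = (\<lambda>g. SOME x. x \<in> K \<and> cell x = g) ` cell ` K"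
    have pick: "(SOME y. y \<in> K \<and> cell y = cell x) \<in> K \<and> cell (SOME y. y \<in> K \<and> cell y = cell x) = cell x"
      if "x \<in> K" for x
      by (rule someI[of "\<lambda>y. y \<in> K \<and> cell y = cell x" x]) (use that in simp)
    have finc: "finite (cell ` K)" using cells fin by (rule finite_subset)
    have "finite E" unfolding E_def using finc by simp
    moreover have "E \<subseteq> K" unfolding E_def using pick by blast
    moreover have "\<exists>y\<in>E. norm (x - y) < r" if x: "x \<in> K" for x
    proof -
      let ?y = "SOME y. y \<in> K \<and> cell y = cell x"
      have "\<bar>x $ k - ?y $ k\<bar> < r / ?n" for k
      proof -
        have "\<lfloor>x $ k * (?n / r)\<rfloor> = \<lfloor>?y $ k * (?n / r)\<rfloor>"
          using fun_cong[OF conjunct2[OF pick[OF x]], of k] by (simp add: cell_def)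
        then have "\<bar>x $ k * (?n / r) - ?y $ k * (?n / r)\<bar> < 1" by linarith
        moreover have "\<bar>x $ k - ?y $ k\<bar> * (?n / r) = \<bar>(x $ k - ?y $ k) * (?n / r)\<bar>"
          using r by (simp add: abs_mult)
        ultimately have "\<bar>x $ k - ?y $ k\<bar> * (?n / r) < 1"
          by (simp only: left_diff_distrib)
        then show ?thesis using n r by (simp add: field_simps)
      qed
      \<comment> \<open>The Euclidean norm is at most the l1 norm, a sum of n terms below r /
        n.\<close>
      then have "(\<Sum>k\<in>UNIV. \<bar>(x - ?y) $ k\<bar>) < (\<Sum>k\<in>(UNIV :: 'n set). r / ?n)"
        by (intro sum_strict_mono) auto
      also have "\<dots> = r" by simp
      finally have "norm (x - ?y) < r" using norm_le_l1_cart[of "x - ?y"] by linarith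
      moreover have "?y \<in> E" unfolding E_def using x by blast
      ultimately show ?thesis by blast
    qed
    moreover have "real (card E) \<le> B ^ CARD('n) * (1 / r) ^ CARD('n)"
    proof -
      have "card E \<le> card (cell ` K)" unfolding E_def by (rule card_image_le[OF finc])
      also have "\<dots> \<le> card (UNIV \<rightarrow>\<^sub>E {- m..m} :: ('n \<Rightarrow> int) set)" by (rule card_mono[OF fin cells])
      also have "\<dots> = nat (2 * m + 1) ^ CARD('n)" by (simp add: card_PiE)
      finally have "real (card E) \<le> real (nat (2 * m + 1)) ^ CARD('n)"
        by (metis of_nat_le_iff of_nat_power)
      also have "\<dots> \<le> (B * (1 / r)) ^ CARD('n)"
      proof (rule power_mono)
        have "real (nat (2 * m + 1)) = 2 * of_int m + 1" using m by simp
        also have "\<dots> \<le> 2 * (R * (?n / r) + 1) + 1"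
        proof -
          have "of_int m \<le> R * (?n / r) + 1"
            unfolding m_def of_int_add of_int_1 by (intro add_right_mono of_int_floor_le)
          then show ?thesis by simp
        qed
        also have "\<dots> = 2 * (R * (?n / r)) + 3" by simp
        also have "\<dots> \<le> 2 * (R * (?n / r)) + 3 * (1 / r)" using r by (simp add: le_divide_eq)
        also have "\<dots> = B * (1 / r)" by (simp add: B_def algebra_simps add_divide_distrib)
        finally show "real (nat (2 * m + 1)) \<le> B * (1 / r)" .
      qed simp
      finally show ?thesis by (simp only: power_mult_distrib)
    qed
    ultimately show "\<exists>E. finite E \<and> E \<subseteq> K \<and> (\<forall>x\<in>K. \<exists>y\<in>E. norm (x - y) < r) \<and>
      real (card E) \<le> B ^ CARD('n) * (1 / r) ^ CARD('n)" by blast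
  qed
qed

section \<open>Upper bounds for the entropy\<close>

lemma log_enat_mono: "a \<le> b \<Longrightarrow> log_enat a \<le> log_enat b"
  by (cases a; cases b) (auto simp: log_enat_def)

text \<open>Monotonicity turns the right limit into a supremum, so the \<open>Lim\<close> in the
  definition of entropy exists and can be bounded pointwise.\<close>

lemma Lim_at_right_antimono_le:
  fixes g :: "real \<Rightarrow> ereal"
  assumes anti: "\<And>s t. a < s \<Longrightarrow> s \<le> t \<Longrightarrow> g t \<le> g s" and le: "\<And>t. a < t \<Longrightarrow> g t \<le> c"
  shows "Lim (at_right a) g \<le> c"
proof -
  let ?l = "SUP t\<in>{a<..}. g t"
  have "(g \<longlongrightarrow> ?l) (at_right a)"
  proof (rule order_tendstoI)
    fix y assume "y < ?l"
    then obtain t where t: "t > a" "y < g t" by (auto simp: less_SUP_iff)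
    have "eventually (\<lambda>s. s \<in> {a<..<t}) (at_right a)" using t by (intro eventually_at_right_real)
    then show "eventually (\<lambda>s. y < g s) (at_right a)"
    proof eventually_elim
      case (elim s) then show ?case using anti[of s t] t by (auto intro: less_le_trans)
    qed
  next
    fix y assume y: "?l < y"
    have "g t < y" if "t > a" for t
      using SUP_upper[of t "{a<..}" g] that y by (auto intro: le_less_trans)
    then show "eventually (\<lambda>t. g t < y) (at_right a)"
      using eventually_at_right_less[of a] by (auto elim: eventually_mono)
  qed
  then have "Lim (at_right a) g = ?l" by (intro tendsto_Lim) auto
  also have "\<dots> \<le> c" using le by (intro SUP_least) auto
  finally show ?thesis .
qed

lemma topological_entropy_le:
  assumes "\<And>\<epsilon>. \<epsilon> > 0 \<Longrightarrow>
    Limsup at_top (\<lambda>T. log_enat (spanning_number N f t0 \<epsilon> T K) / ereal T) \<le> c"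
  shows "topological_entropy N f t0 K \<le> c"
  unfolding topological_entropy_def
proof (rule Lim_at_right_antimono_le[OF _ assms])
  fix s t :: real assume st: "0 < s" "s \<le> t"
  have "spanning_number N f t0 t T K \<le> spanning_number N f t0 s T K" for T
    unfolding spanning_number_def
  proof (rule INF_superset_mono)
    have "entropy_ball N f t0 x s T \<subseteq> entropy_ball N f t0 x t T" for x
      using st by (auto simp: entropy_ball_def)
    then show "{E. finite E \<and> is_spanning N f t0 s T K E} \<subseteq> {E. finite E \<and> is_spanning N f t0 t T K E}"
      unfolding is_spanning_def by (blast dest: subsetD)
  qed simp
  then have "log_enat (spanning_number N f t0 t T K) / ereal T \<le> log_enat (spanning_number N f t0 s T K) / ereal T"
    if "T > 0" for T
    using that by (intro ereal_divide_right_mono log_enat_mono) auto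
  then show "Limsup at_top (\<lambda>T. log_enat (spanning_number N f t0 t T K) / ereal T) \<le>
      Limsup at_top (\<lambda>T. log_enat (spanning_number N f t0 s T K) / ereal T)"
    by (intro Limsup_mono eventually_mono[OF eventually_gt_at_top[of 0]])
qed

lemma topological_entropy_le_exponential:
  fixes K :: "(real ^ 'n) set"
  assumes K: "bounded K" and C: "C > 0" and c: "c \<ge> 0"
    and exp: "\<And>x y t. x \<in> K \<Longrightarrow> y \<in> K \<Longrightarrow> t \<ge> t0 \<Longrightarrow>
      N (xi f t t0 x - xi f t t0 y) \<le> C * exp (c * (t - t0)) * norm (x - y)"
  shows "topological_entropy N f t0 K \<le> ereal (real CARD('n) * c)"
proof (rule topological_entropy_le)
  fix \<epsilon> :: real assume \<epsilon>: "\<epsilon> > 0"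
  let ?n = "CARD('n)"
  obtain M where M: "M > 0"
    "\<forall>r\<in>{0<..1}. \<exists>E. finite E \<and> E \<subseteq> K \<and> (\<forall>x\<in>K. \<exists>y\<in>E. norm (x - y) < r) \<and>
      real (card E) \<le> M * (1 / r) ^ ?n"
    using finite_cover_card[OF K] by metis
  \<comment> \<open>The 2 yields the strict inequality C \<rho> < \<epsilon>; the cap 1 keeps the
    radii below within the range of the covering lemma.\<close>
  define \<rho> where "\<rho> = min 1 (\<epsilon> / (2 * C))"
  have \<rho>: "0 < \<rho>" "\<rho> \<le> 1" "C * \<rho> < \<epsilon>"
  proof -
    show "0 < \<rho>" using \<epsilon> C by (simp add: \<rho>_def)
    show "\<rho> \<le> 1" by (simp add: \<rho>_def)
    have "C * \<rho> \<le> C * (\<epsilon> / (2 * C))" using C by (intro mult_left_mono) (simp_all add: \<rho>_def)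
    also have "\<dots> < \<epsilon>" using C \<epsilon> by simp
    finally show "C * \<rho> < \<epsilon>" .
  qed
  define b where "b = ln (max 1 (M * (1 / \<rho>) ^ ?n))"
  have bound: "log_enat (spanning_number N f t0 \<epsilon> T K) / ereal T \<le> ereal (b / T + real ?n * c)"
    if T: "T > 0" for T
  proof -
    \<comment> \<open>Shrinks at the rate at which distances can grow, so that they stay below C
      \<rho> up to time T. Since c \<ge> 0, r stays below 1 and the worst growth factor is the one
      at the final time.\<close>
    define r where "r = \<rho> * exp (- c * T)"
    have r: "0 < r" "r \<le> 1"
      using \<rho> c T by (auto simp: r_def intro!: mult_le_one)
    obtain E where E: "finite E" "E \<subseteq> K" "\<And>x. x \<in> K \<Longrightarrow> \<exists>y\<in>E. norm (x - y) < r"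
      "real (card E) \<le> M * (1 / r) ^ ?n"
      using M(2) r by (metis greaterThanAtMost_iff)
    have "is_spanning N f t0 \<epsilon> T K E"
      unfolding is_spanning_def
    proof (intro conjI E(2) subsetI)
      fix x assume x: "x \<in> K"
      obtain y where y: "y \<in> E" "norm (x - y) < r" using E(3)[OF x] by blast
      have "(SUP t\<in>{t0..t0 + T}. N (xi f t t0 x - xi f t t0 y)) \<le> C * exp (c * T) * r"
      proof (rule cSUP_least)
        fix t assume t: "t \<in> {t0..t0 + T}"
        have "N (xi f t t0 x - xi f t t0 y) \<le> C * exp (c * (t - t0)) * norm (x - y)"
          using exp[OF x, of y t] y E(2) t by auto
        also have "\<dots> \<le> C * exp (c * T) * r"
          using C c t y(2) by (intro mult_mono) (auto intro!: mult_left_mono)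
        finally show "N (xi f t t0 x - xi f t t0 y) \<le> C * exp (c * T) * r" .
      qed (use T in simp)
      also have "C * exp (c * T) * r = C * \<rho> * (exp (c * T) * exp (- c * T))"
        by (simp only: r_def mult_ac)
      also have "exp (c * T) * exp (- c * T) = 1" by (simp flip: exp_add)
      finally have "(SUP t\<in>{t0..t0 + T}. N (xi f t t0 x - xi f t t0 y)) < \<epsilon>" using \<rho>(3) by simp
      then show "x \<in> (\<Union>y\<in>E. entropy_ball N f t0 y \<epsilon> T)"
        using y(1) by (auto simp: entropy_ball_def)
    qed
    then have "spanning_number N f t0 \<epsilon> T K \<le> enat (card E)"
      unfolding spanning_number_def using E(1) by (intro INF_lower) simp
    then have "log_enat (spanning_number N f t0 \<epsilon> T K) \<le> log_enat (enat (card E))"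
      by (rule log_enat_mono)
    also have "\<dots> \<le> ereal (b + real ?n * c * T)"
    proof (cases "card E = 0")
      case False
      have "(1 / r) ^ ?n = (1 / \<rho>) ^ ?n * exp (real ?n * c * T)"
        using \<rho> by (simp add: r_def power_mult_distrib power_divide exp_minus field_simps flip: exp_of_nat_mult)
      then have "real (card E) \<le> M * (1 / \<rho>) ^ ?n * exp (real ?n * c * T)"
        using E(4) by (simp add: mult.assoc)
      also have "\<dots> \<le> max 1 (M * (1 / \<rho>) ^ ?n) * exp (real ?n * c * T)"
        by (intro mult_right_mono) auto
      finally have "ln (real (card E)) \<le> ln (max 1 (M * (1 / \<rho>) ^ ?n) * exp (real ?n * c * T))"
        using False by (intro ln_mono) (auto simp: less_max_iff_disj)
      also have "\<dots> = b + real ?n * c * T"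
        unfolding b_def by (subst ln_mult) (auto simp: less_max_iff_disj)
      finally show ?thesis using False by (simp add: log_enat_def)
    qed (simp add: log_enat_def)
    finally have "log_enat (spanning_number N f t0 \<epsilon> T K) / ereal T \<le> ereal (b + real ?n * c * T) / ereal T"
      using T by (intro ereal_divide_right_mono) auto
    also have "\<dots> = ereal (b / T + real ?n * c)" using T by (simp add: add_divide_distrib)
    finally show ?thesis .
  qed
  have "((\<lambda>T. b / T + real ?n * c) \<longlongrightarrow> 0 + real ?n * c) at_top"
    by (intro tendsto_intros tendsto_divide_0[OF tendsto_const]) (simp add: filterlim_at_top_imp_at_infinity filterlim_ident)
  then have lim: "((\<lambda>T. ereal (b / T + real ?n * c)) \<longlongrightarrow> ereal (real ?n * c)) at_top"
    by simp
  have "Limsup at_top (\<lambda>T. log_enat (spanning_number N f t0 \<epsilon> T K) / ereal T) \<le>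
      Limsup at_top (\<lambda>T. ereal (b / T + real ?n * c))"
    by (intro Limsup_mono eventually_mono[OF eventually_gt_at_top[of 0]]) (rule bound)
  also have "\<dots> = ereal (real ?n * c)"
    by (rule lim_imp_Limsup[OF _ lim]) simp
  finally show "Limsup at_top (\<lambda>T. log_enat (spanning_number N f t0 \<epsilon> T K) / ereal T) \<le> ereal (real ?n * c)" .
qed

section \<open>Interconnected systems\<close>

locale interconnected_system = complete_system f t0 + block_norms blk nrm
  for f :: "real \<Rightarrow> real ^ 'n \<Rightarrow> real ^ 'n" and t0 :: real
    and blk :: "'n \<Rightarrow> 'm::finite" and nrm :: "'m \<Rightarrow> real ^ 'n \<Rightarrow> real"
begin

lemma interconnection_matrix_eq:
  "interconnection_matrix blk nrm f t v = interconnection (jacobian (f t) (at v))"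
  by (simp add: interconnection_matrix_def interconnection_def)

lemma flow_wnorm_growth:
  assumes ab: "t0 \<le> a" "a \<le> b"
    and w: "\<And>i. w $ i > 0" and Bw: "\<And>i. (B *v w) $ i \<le> c * w $ i"
    and bound: "\<And>t v i j. t \<ge> a \<Longrightarrow> v \<in> closed_segment (flow x t) (flow y t) \<Longrightarrow>
      interconnection_matrix blk nrm f t v $ i $ j \<le> B $ i $ j"
  shows "wnorm w (flow x b - flow y b) \<le> exp (c * (b - a)) * wnorm w (flow x a - flow y a)"
proof -
  obtain S where S: "countable S"
    "\<And>t x \<phi>. solution_from f t0 x \<phi> \<Longrightarrow> t \<ge> t0 \<Longrightarrow> t \<notin> S \<Longrightarrow>
      (\<phi> has_vector_derivative f t (\<phi> t)) (at t within {t..})"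
    using solution_right_derivative by blast
  show ?thesis
  proof (rule wnorm_growth[OF ab(2) _ S(1) w Bw, where e = "\<lambda>t. flow x t - flow y t"])
    have "continuous_on {a..b} (flow z)" for z
      by (rule continuous_on_subset[OF solution_continuous_on[OF flow_solution]]) (use ab in auto)
    then show "continuous_on {a..b} (\<lambda>t. flow x t - flow y t)" by (intro continuous_intros)
    fix t assume t: "t \<in> {a..<b} - S"
    have "f t differentiable at v" "continuous_on UNIV (\<lambda>v. jacobian (f t) (at v))" for v
      using C1 t ab unfolding C1_in_state_def by auto
    then obtain A where A: "A \<in> convex hull ((\<lambda>v. jacobian (f t) (at v)) ` closed_segment (flow x t) (flow y t))"
      "f t (flow x t) - f t (flow y t) = A *v (flow x t - flow y t)"
      by (rule mean_value_jacobian[of "f t"])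
    have "A \<in> {A. \<forall>i j. interconnection A $ i $ j \<le> B $ i $ j}"
      using bound t
      by (intro subsetD[OF hull_minimal A(1)] convex_interconnection_le)
        (auto simp: interconnection_matrix_eq)
    moreover have "((\<lambda>t. flow x t - flow y t) has_vector_derivative A *v (flow x t - flow y t)) (at t within {t..})"
      unfolding A(2)[symmetric] using t ab by (intro derivative_intros S(2)[OF flow_solution]) auto
    ultimately show "\<exists>A. ((\<lambda>t. flow x t - flow y t) has_vector_derivative A *v (flow x t - flow y t)) (at t within {t..}) \<and>
        (\<forall>i j. interconnection A $ i $ j \<le> B $ i $ j)" by blast
  qed
qed

lemma flow_exponential_bound:
  assumes K: "compact K" and N: "norm_on UNIV N" and c: "c \<ge> 0" and a: "t0 \<le> a"
    and w: "\<And>i. w $ i > 0" and Bw: "\<And>i. (B *v w) $ i \<le> c * w $ i"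
    and bound: "\<And>t v i j. t \<ge> a \<Longrightarrow> v \<in> convex hull ((\<lambda>x. flow x t) ` K) \<Longrightarrow>
      interconnection_matrix blk nrm f t v $ i $ j \<le> B $ i $ j"
  obtains C where "C > 0"
    "\<And>x y t. x \<in> K \<Longrightarrow> y \<in> K \<Longrightarrow> t \<ge> t0 \<Longrightarrow>
      N (flow x t - flow y t) \<le> C * exp (c * (t - t0)) * norm (x - y)"
proof -
  have no: "norm_on UNIV (wnorm w)" by (rule norm_on_wnorm[OF w])
  obtain L where L: "L \<ge> 1"
    "\<And>x y t. x \<in> K \<Longrightarrow> y \<in> K \<Longrightarrow> t \<in> {t0..a} \<Longrightarrow> norm (flow x t - flow y t) \<le> L * norm (x - y)"
    using flow_lipschitz_on_compact[OF a K] by metis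
  obtain p where p: "p > 0" "\<And>v. wnorm w v \<le> p * norm v" using norm_on_UNIV_bound[OF no] by metis
  obtain q where q: "q > 0" "\<And>v. norm v \<le> q * wnorm w v" using norm_on_UNIV_lower_bound[OF no] by metis
  obtain r where r: "r > 0" "\<And>v. N v \<le> r * norm v" using norm_on_UNIV_bound[OF N] by metis
  show thesis
  proof
    \<comment> \<open>Must dominate L up to time a, and q p L afterwards, when the estimate passes
      to the weighted norm and back.\<close>
    define D where "D = max 1 (q * p) * L"
    have D: "D \<ge> L" "D \<ge> q * p * L" "D > 0"
      using L(1) mult_right_mono[of 1 "max 1 (q * p)" L] mult_right_mono[of "q * p" "max 1 (q * p)" L]
      by (auto simp: D_def)
    show "r * D > 0" using r(1) D(3) by simp
    fix x y t assume xy: "x \<in> K" "y \<in> K" and t: "t \<ge> t0"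
    have "norm (flow x t - flow y t) \<le> D * exp (c * (t - t0)) * norm (x - y)"
    proof (cases "t \<le> a")
      case True
      have "norm (flow x t - flow y t) \<le> L * 1 * norm (x - y)" using L(2)[OF xy] True t by simp
      also have "\<dots> \<le> D * exp (c * (t - t0)) * norm (x - y)"
        using D L(1) c t by (intro mult_right_mono mult_mono) auto
      finally show ?thesis .
    next
      case False
      have "closed_segment (flow x s) (flow y s) \<subseteq> convex hull ((\<lambda>x. flow x s) ` K)" for s
        using xy by (intro closed_segment_subset convex_convex_hull hull_inc imageI)
      then have *: "wnorm w (flow x t - flow y t) \<le> exp (c * (t - a)) * wnorm w (flow x a - flow y a)"
        using a False by (intro flow_wnorm_growth[OF _ _ w Bw] bound) auto
      have "norm (flow x t - flow y t) \<le> q * wnorm w (flow x t - flow y t)" by (rule q)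
      also have "\<dots> \<le> q * (exp (c * (t - a)) * wnorm w (flow x a - flow y a))"
        using q(1) by (intro mult_left_mono *) auto
      \<comment> \<open>Restarting the clock at t0 instead of a only enlarges the exponential,
        because c \<ge> 0.\<close>
      also have "\<dots> \<le> q * (exp (c * (t - t0)) * (p * (L * norm (x - y))))"
      proof (intro mult_left_mono mult_mono)
        show "wnorm w (flow x a - flow y a) \<le> p * (L * norm (x - y))"
          using a p(1) by (intro order_trans[OF p(2)] mult_left_mono L(2)[OF xy]) auto
        show "0 \<le> wnorm w (flow x a - flow y a)" using no by (simp add: norm_on_def)
      qed (use q c a in \<open>auto intro: mult_left_mono\<close>)
      also have "\<dots> = q * p * L * (exp (c * (t - t0)) * norm (x - y))" by (simp only: mult_ac)
      also have "\<dots> \<le> D * (exp (c * (t - t0)) * norm (x - y))"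
        using D by (intro mult_right_mono) auto
      finally show ?thesis by (simp only: mult_ac)
    qed
    then have "r * norm (flow x t - flow y t) \<le> r * (D * exp (c * (t - t0)) * norm (x - y))"
      using r(1) by simp
    then show "N (flow x t - flow y t) \<le> r * D * exp (c * (t - t0)) * norm (x - y)"
      using r(2)[of "flow x t - flow y t"] by (simp add: mult.assoc)
  qed
qed

lemma entropy_le_of_gt_lambda_max:
  assumes K: "compact K" and N: "norm_on UNIV N" and M: "metzler M"
    and limsup: "\<And>i j. Limsup at_top (\<lambda>t. SUP v\<in>convex hull (xi f t t0 ` K).
      ereal (interconnection_matrix blk nrm f t v $ i $ j)) \<le> ereal (M $ i $ j)"
    and c: "c \<ge> 0" "lambda_max M < c"
  shows "topological_entropy N f t0 K \<le> ereal (real CARD('n) * c)"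
proof -
  obtain w where w: "\<And>i. w $ i > 0" "\<And>i. (M *v w) $ i < c * w $ i"
    using metzler_positive_supersolution[OF M c(2)] by metis
  define s where "s = (\<Sum>i\<in>UNIV. w $ i)"
  have s: "s > 0" unfolding s_def using w(1) by (intro sum_pos) auto
  \<comment> \<open>Raising all entries of M by \<delta> raises each entry of M w by \<delta> s;
    this is the largest \<delta> that the slack in M w < c w permits.\<close>
  define \<delta> where "\<delta> = Min (range (\<lambda>i. (c * w $ i - (M *v w) $ i) / s))"
  have \<delta>: "\<delta> > 0" unfolding \<delta>_def using w(2) s by (subst Min_gr_iff) auto
  define B where "B = (\<chi> i j. M $ i $ j + \<delta>)"
  have Bw: "(B *v w) $ i \<le> c * w $ i" for i
  proof -
    have "\<delta> \<le> (c * w $ i - (M *v w) $ i) / s" unfolding \<delta>_def by (rule Min_le) auto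
    then have "\<delta> * s \<le> c * w $ i - (M *v w) $ i" using s by (simp add: field_simps)
    moreover have "(B *v w) $ i = (M *v w) $ i + \<delta> * s"
      by (simp add: B_def s_def matrix_vector_mult_def distrib_right sum.distrib sum_distrib_left)
    ultimately show ?thesis by simp
  qed
  have "eventually (\<lambda>t. (SUP v\<in>convex hull (xi f t t0 ` K).
      ereal (interconnection_matrix blk nrm f t v $ i $ j)) < ereal (B $ i $ j)) at_top" for i j
    using \<delta> by (intro Limsup_lessD le_less_trans[OF limsup]) (simp add: B_def)
  then have "eventually (\<lambda>t. \<forall>i j. (SUP v\<in>convex hull (xi f t t0 ` K).
      ereal (interconnection_matrix blk nrm f t v $ i $ j)) < ereal (B $ i $ j)) at_top"
    by (intro eventually_all_finite)
  then obtain a0 where a0: "\<And>t i j. t \<ge> a0 \<Longrightarrow> (SUP v\<in>convex hull (xi f t t0 ` K).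
      ereal (interconnection_matrix blk nrm f t v $ i $ j)) < ereal (B $ i $ j)"
    unfolding eventually_at_top_linorder by blast
  have bound: "interconnection_matrix blk nrm f t v $ i $ j \<le> B $ i $ j"
    if "t \<ge> max a0 t0" "v \<in> convex hull (xi f t t0 ` K)" for t v i j
  proof -
    have "ereal (interconnection_matrix blk nrm f t v $ i $ j) \<le>
        (SUP v\<in>convex hull (xi f t t0 ` K). ereal (interconnection_matrix blk nrm f t v $ i $ j))"
      by (rule SUP_upper[OF that(2)])
    also have "\<dots> < ereal (B $ i $ j)" using a0 that(1) by simp
    finally show ?thesis by simp
  qed
  show ?thesis
  proof (rule flow_exponential_bound[OF K N c(1) max.cobounded2 w(1) Bw bound])
    fix C assume "C > 0" and "\<And>x y t. x \<in> K \<Longrightarrow> y \<in> K \<Longrightarrow> t \<ge> t0 \<Longrightarrow>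
      N (flow x t - flow y t) \<le> C * exp (c * (t - t0)) * norm (x - y)"
    then show ?thesis
      using c(1) by (intro topological_entropy_le_exponential[OF compact_imp_bounded[OF K]])
  qed
qed

end

theorem theorem2:
  fixes f :: "real \<Rightarrow> real ^ 'n \<Rightarrow> real ^ 'n"
    and t0 :: real
    and K :: "(real ^ 'n) set"
    and blk :: "'n \<Rightarrow> 'm::finite"
    and nrm :: "'m \<Rightarrow> real ^ 'n \<Rightarrow> real"
    and N :: "real ^ 'n \<Rightarrow> real"
    and A_hat :: "real ^ 'm ^ 'm"
  assumes "CARD('m) \<ge> 2"
    and "surj blk"
    and "\<And>x. piecewise_continuous_from t0 (\<lambda>t. f t x)"
    and "C1_in_state t0 f"
    and "forward_complete t0 f"
    and "\<And>i. norm_on (block_space blk i) (nrm i)"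
    and "norm_on UNIV N"
    and "compact K" and "interior K \<noteq> {}"
    and "metzler A_hat"
    and "\<And>i j. Limsup at_top (\<lambda>t. SUP v\<in>convex hull (xi f t t0 ` K).
                  ereal (interconnection_matrix blk nrm f t v $ i $ j)) \<le> ereal (A_hat $ i $ j)"
  shows "topological_entropy N f t0 K \<le> ereal (real CARD('n) * max (lambda_max A_hat) 0)"
proof -
  interpret interconnected_system f t0 blk nrm
    by unfold_locales (fact assms)+
  let ?l = "max (lambda_max A_hat) 0"
  have "topological_entropy N f t0 K \<le> ereal (real CARD('n) * ?l) + ereal \<epsilon>" if \<epsilon>: "\<epsilon> > 0" for \<epsilon>
  proof -
    \<comment> \<open>Exceeding the claimed rate by \<epsilon> / n costs exactly \<epsilon> in the
      entropy bound.\<close>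
    define c where "c = ?l + \<epsilon> / real CARD('n)"
    have "\<epsilon> / real CARD('n) > 0" using \<epsilon> by simp
    then have "c \<ge> 0" "lambda_max A_hat < c" by (auto simp: c_def)
    then have "topological_entropy N f t0 K \<le> ereal (real CARD('n) * c)"
      by (intro entropy_le_of_gt_lambda_max[OF assms(8,7,10,11)])
    also have "real CARD('n) * c = real CARD('n) * ?l + \<epsilon>" by (simp add: c_def distrib_left)
    finally show ?thesis by simp
  qed
  then show ?thesis by (rule ereal_le_epsilon2)
qed

end
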